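(* Consider the eigenvalue problem $$-\left(\varphi_p(u')\right)'+q(x)\varphi_p(u)=\lambda m(x)\varphi_p(u),\quad 0<x<T,\qquad u(0)=u(T),\ u'(0)=u'(T),\qquad (E)$$ with its smallest positive eigenvalue $\lambda_0^+$ and largest negative eigenvalue $\lambda_0^-$ given by the variational formulas in the context. Then: 1. If $\lambda_0^-<\lambda<\lambda_0^+$, then (E) has no nontrivial solution. 2. The eigenfunctions associated to $\lambda_0^+$ or $\lambda_0^-$ are either positive or negative on $[0,T]$. 3. $\lambda_0^+$ and $\lambda_0^-$ are simple, in the sense that the eigenfunctions associated to each of them are merely constant multiples of each other. 4. Any eigenfunction $u$ associated to an eigenvalue $\lambda$ with $\lambda\neq\lambda_0^+$ and $\lambda\neq\lambda_0^-$ changes sign.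
   Context: Here $T>0$, $1<p<+\infty$, $\varphi_p(s)=|s|^{p-2}s$ (with $\varphi_p(0)=0$), $q\in C([0,T];[0,+\infty))$ with $q\not\equiv0$, and $m:[0,T]\to\mathbb{R}$ is a continuous sign-changing weight (it takes both positive and negative values). $W_T^{1,p}(0,T)=\{u\in W^{1,p}(0,T)\mid u(0)=u(T)\}$. A real number $\lambda$ is an eigenvalue of (E) if (E) has a nontrivial solution $u$ (an eigenfunction associated to $\lambda$). The numbers $\lambda_0^\pm$ are $\lambda_0^+=\inf\{\int_0^T(|u'|^p+q|u|^p)\,dx\mid u\in W_T^{1,p}(0,T),\ \int_0^T m|u|^p\,dx=1\}>0$ and $\lambda_0^-=\max\{-\int_0^T(|u'|^p+q|u|^p)\,dx\mid u\in W_T^{1,p}(0,T),\ \int_0^T -m|u|^p\,dx=1\}<0$; both are eigenvalues of (E). *)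

theory Defs
  imports "HOL-Analysis.Analysis"
begin

text \<open>
  All functions on \<open>[0,T]\<close> are total functions \<open>real \<Rightarrow> real\<close> of which only the restriction to
  \<open>{0..T}\<close> is ever used.
\<close>

definition phi_p :: "real \<Rightarrow> real \<Rightarrow> real" where
  "phi_p p s = \<bar>s\<bar> powr (p - 2) * s"

subsection \<open>The Sobolev space of periodic functions\<close>

definition in_Lp :: "real \<Rightarrow> real \<Rightarrow> (real \<Rightarrow> real) \<Rightarrow> bool" where
  "in_Lp T p f \<longleftrightarrow>
     set_borel_measurable lebesgue {0<..<T} f \<and>
     set_integrable lebesgue {0<..<T} (\<lambda>x. \<bar>f x\<bar> powr p)"

text \<open>\<open>C\<^sub>c\<^sup>1(0,T)\<close>, extended by zero to the whole line.\<close>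

definition test_function :: "real \<Rightarrow> (real \<Rightarrow> real) \<Rightarrow> bool" where
  "test_function T \<eta> \<longleftrightarrow>
     \<eta> C1_differentiable_on UNIV \<and>
     compact (closure {x. \<eta> x \<noteq> 0}) \<and> closure {x. \<eta> x \<noteq> 0} \<subseteq> {0<..<T}"

definition weak_derivative :: "real \<Rightarrow> (real \<Rightarrow> real) \<Rightarrow> (real \<Rightarrow> real) \<Rightarrow> bool" where
  "weak_derivative T u v \<longleftrightarrow>
     (\<forall>\<eta>. test_function T \<eta> \<longrightarrow>
        (LINT x:{0<..<T}|lebesgue. u x * deriv \<eta> x) =
        - (LINT x:{0<..<T}|lebesgue. v x * \<eta> x))"

text \<open>
  \<open>W1p_deriv T p u v\<close>: \<open>u\<close> is the continuous representative on \<open>[0,T]\<close> of an element of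
  \<open>W\<^sup>1\<^sup>,\<^sup>p(0,T)\<close> (defined, as in Brezis, with \<open>C\<^sub>c\<^sup>1\<close> test functions), and \<open>v\<close> is its weak
  derivative, which is unique up to null sets.  Working with the continuous representative is what
  gives \<open>u 0\<close> and \<open>u T\<close> their meaning.
\<close>

definition W1p_deriv :: "real \<Rightarrow> real \<Rightarrow> (real \<Rightarrow> real) \<Rightarrow> (real \<Rightarrow> real) \<Rightarrow> bool" where
  "W1p_deriv T p u v \<longleftrightarrow>
     continuous_on {0..T} u \<and> in_Lp T p u \<and> in_Lp T p v \<and> weak_derivative T u v"

definition W1p_periodic_deriv :: "real \<Rightarrow> real \<Rightarrow> (real \<Rightarrow> real) \<Rightarrow> (real \<Rightarrow> real) \<Rightarrow> bool" where
  "W1p_periodic_deriv T p u v \<longleftrightarrow> W1p_deriv T p u v \<and> u 0 = u T"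

subsection \<open>The variational eigenvalues\<close>

definition energy ::
    "real \<Rightarrow> real \<Rightarrow> (real \<Rightarrow> real) \<Rightarrow> (real \<Rightarrow> real) \<Rightarrow> (real \<Rightarrow> real) \<Rightarrow> real" where
  "energy T p q u v = (LINT x:{0<..<T}|lebesgue. \<bar>v x\<bar> powr p + q x * \<bar>u x\<bar> powr p)"

definition lambda0_plus :: "real \<Rightarrow> real \<Rightarrow> (real \<Rightarrow> real) \<Rightarrow> (real \<Rightarrow> real) \<Rightarrow> real" where
  "lambda0_plus T p q m =
     Inf {energy T p q u v | u v. W1p_periodic_deriv T p u v \<and>
            (LINT x:{0<..<T}|lebesgue. m x * \<bar>u x\<bar> powr p) = 1}"

text \<open>The supremum is attained, so it is the maximum.\<close>

definition lambda0_minus :: "real \<Rightarrow> real \<Rightarrow> (real \<Rightarrow> real) \<Rightarrow> (real \<Rightarrow> real) \<Rightarrow> real" where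
  "lambda0_minus T p q m =
     Sup {- energy T p q u v | u v. W1p_periodic_deriv T p u v \<and>
            (LINT x:{0<..<T}|lebesgue. - m x * \<bar>u x\<bar> powr p) = 1}"

subsection \<open>Solutions, eigenfunctions, eigenvalues\<close>

text \<open>
  Classical solutions: \<open>u \<in> C\<^sup>1[0,T]\<close> (one-sided derivatives at the end points, with derivative
  \<open>u'\<close>), \<open>\<phi>\<^sub>p(u')\<close> differentiable on \<open>(0,T)\<close> with derivative \<open>w\<close>.
\<close>

definition solution_E ::
    "real \<Rightarrow> real \<Rightarrow> (real \<Rightarrow> real) \<Rightarrow> (real \<Rightarrow> real) \<Rightarrow> real \<Rightarrow> (real \<Rightarrow> real) \<Rightarrow> bool" where
  "solution_E T p q m lam u \<longleftrightarrow>
     (\<exists>u'. continuous_on {0..T} u' \<and>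
        (\<forall>x\<in>{0..T}. (u has_real_derivative u' x) (at x within {0..T})) \<and>
        (\<forall>x\<in>{0<..<T}. \<exists>w. ((\<lambda>y. phi_p p (u' y)) has_real_derivative w) (at x) \<and>
            - w + q x * phi_p p (u x) = lam * m x * phi_p p (u x)) \<and>
        u 0 = u T \<and> u' 0 = u' T)"

definition nontrivial_on :: "real \<Rightarrow> (real \<Rightarrow> real) \<Rightarrow> bool" where
  "nontrivial_on T u \<longleftrightarrow> (\<exists>x\<in>{0..T}. u x \<noteq> 0)"

definition eigenfunction_E ::
    "real \<Rightarrow> real \<Rightarrow> (real \<Rightarrow> real) \<Rightarrow> (real \<Rightarrow> real) \<Rightarrow> real \<Rightarrow> (real \<Rightarrow> real) \<Rightarrow> bool" where
  "eigenfunction_E T p q m lam u \<longleftrightarrow> solution_E T p q m lam u \<and> nontrivial_on T u"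

definition eigenvalue_E ::
    "real \<Rightarrow> real \<Rightarrow> (real \<Rightarrow> real) \<Rightarrow> (real \<Rightarrow> real) \<Rightarrow> real \<Rightarrow> bool" where
  "eigenvalue_E T p q m lam \<longleftrightarrow> (\<exists>u. eigenfunction_E T p q m lam u)"

definition changes_sign_on :: "real \<Rightarrow> (real \<Rightarrow> real) \<Rightarrow> bool" where
  "changes_sign_on T u \<longleftrightarrow> (\<exists>x\<in>{0..T}. u x > 0) \<and> (\<exists>x\<in>{0..T}. u x < 0)"

end

(*
  A positive solution u for the eigenvalue lambda yields, through Picone's inequality (equivalently, the
  Riccati equation for G = phi_p(u'/u) paired with |w|^p), energy(w) >= lambda * mass(w) for every periodic
  w in W^{1,p}, where mass(w) is the integral of m |w|^p. Hence a positive eigenvalue with a one-signed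
  eigenfunction equals lambda_0^+, and the equality case of Picone's inequality gives simplicity.

  An eigenfunction for lambda_0^+ cannot change sign: cut it off outside a nodal interval and add a small
  constant t > 0. The derivative of energy - lambda_0^+ * mass in t at 0 is, up to the factor p, the jump of
  the flux phi_p(u') across the nodal interval, which is strictly negative because zeros of u are simple;
  this contradicts the variational definition of lambda_0^+. So no Euler-Lagrange equation or
  regularity theory for minimizers is required, and neither is the attainment of the infimum.

  Replacing m by -m exchanges lambda_0^+ and -lambda_0^-.
*)
theory Submission
  imports Defs
begin

subsection \<open>The function \<open>\<phi>\<^sub>p\<close>\<close>

text \<open>Two obstacles shape the proof. Uniqueness is required only at double zeros, and there it
  survives because both sides of the equation are homogeneous of degree p - 1. Secondly, Picone's
  argument integrates the derivative of G |w|^p for a competitor w whose derivative is known only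
  through test functions. The fundamental theorem of calculus for w is recovered from plateau-shaped
  test functions. The product and chain rule is then proved on the level of increments over short
  intervals, which avoids differentiation almost everywhere.

  The assumption that q does not vanish identically serves to make the energy of every nontrivial
  solution strictly positive. This excludes the eigenvalue 0, which lies between the two extremal
  eigenvalues, and fixes the sign of the mass of an eigenfunction.\<close>

lemma phi_p_0 [simp]: "phi_p p 0 = 0"
  by (simp add: phi_p_def)

lemma phi_p_minus [simp]: "phi_p p (- s) = - phi_p p s"
  by (simp add: phi_p_def)

lemma phi_p_mult: "phi_p p (a * b) = phi_p p a * phi_p p b"
  by (simp add: phi_p_def abs_mult powr_mult)

lemma phi_p_pos: "s > 0 \<Longrightarrow> phi_p p s = s powr (p - 1)"
  unfolding phi_p_def using powr_add[of s "p - 2" 1] by simp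

lemma abs_phi_p: "\<bar>phi_p p s\<bar> = \<bar>s\<bar> powr (p - 1)"
  unfolding phi_p_def using powr_add[of "\<bar>s\<bar>" "p - 2" 1] by (simp add: abs_mult)

lemma phi_p_eq_0_iff [simp]: "phi_p p s = 0 \<longleftrightarrow> s = 0"
  by (simp add: phi_p_def)

lemma phi_p_times_self: "phi_p p s * s = \<bar>s\<bar> powr p"
proof (cases "s = 0")
  case False
  then have "\<bar>s\<bar> powr p = \<bar>s\<bar> powr (p - 2) * \<bar>s\<bar> powr 2"
    using powr_add[of "\<bar>s\<bar>" "p - 2" 2] by simp
  also have "\<bar>s\<bar> powr 2 = s * s"
    using False by (simp add: powr_numeral power2_eq_square)
  finally show ?thesis by (simp add: phi_p_def)
qed simp

text \<open>For p < 2 the factor \<open>\<bar>s\<bar> powr (p - 2)\<close> blows up at 0. Here only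
  the exponent p - 1 > 0 occurs, so continuity and monotonicity across 0 become visible.\<close>

lemma phi_p_pos_neg_parts:
  "p > 1 \<Longrightarrow> phi_p p s = (max s 0) powr (p - 1) - (max (- s) 0) powr (p - 1)"
  using phi_p_pos[of s p] phi_p_pos[of "- s" p] by (cases s "0::real" rule: linorder_cases) auto

lemma continuous_on_phi_p [continuous_intros]:
  assumes "p > 1" "continuous_on S f"
  shows "continuous_on S (\<lambda>x. phi_p p (f x))"
  unfolding phi_p_pos_neg_parts[OF assms(1)]
  using assms by (intro continuous_intros continuous_on_powr') auto

lemma phi_p_strict_mono:
  assumes "p > 1" "s < t"
  shows "phi_p p s < phi_p p t"
proof -
  have 1: "max s 0 powr (p - 1) \<le> max t 0 powr (p - 1)"
    using assms by (intro powr_mono2) auto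
  have 2: "max (- t) 0 powr (p - 1) \<le> max (- s) 0 powr (p - 1)"
    using assms by (intro powr_mono2) auto
  consider "t > 0" | "s < 0" using assms(2) by linarith
  then show ?thesis
  proof cases
    case 1
    then have "max s 0 powr (p - 1) < max t 0 powr (p - 1)"
      using assms by (intro powr_less_mono2) auto
    with 2 show ?thesis by (simp add: phi_p_pos_neg_parts[OF assms(1)])
  next
    case 2
    then have "max (- t) 0 powr (p - 1) < max (- s) 0 powr (p - 1)"
      using assms by (intro powr_less_mono2) auto
    with 1 show ?thesis by (simp add: phi_p_pos_neg_parts[OF assms(1)])
  qed
qed

lemma DERIV_abs_powr:
  assumes "p > 1"
  shows "((\<lambda>s. \<bar>s\<bar> powr p) has_real_derivative p * phi_p p s) (at s)"
proof (cases s "0::real" rule: linorder_cases)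
  case greater
  have "((\<lambda>s. s powr p) has_real_derivative p * phi_p p s) (at s)"
    using has_real_derivative_powr[OF greater, of p] greater by (simp add: phi_p_pos)
  then show ?thesis
    by (rule has_field_derivative_transform_within_open[where S = "{0<..}"]) (use greater in auto)
next
  case less
  have "((\<lambda>s. (- s) powr p) has_real_derivative p * phi_p p s) (at s)"
  proof -
    have "phi_p p s = - ((- s) powr (p - 1))"
      using less phi_p_pos[of "- s" p] by simp
    then show ?thesis
      using less by (auto intro!: derivative_eq_intros)
  qed
  then show ?thesis
    by (rule has_field_derivative_transform_within_open[where S = "{..<0}"]) (use less in auto)
next
  case equal
  have "continuous_on UNIV (phi_p p)"
    using continuous_on_phi_p[OF assms continuous_on_id] by simp
  then have "(phi_p p \<longlongrightarrow> phi_p p 0) (at 0)"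
    by (simp add: continuous_on_eq_continuous_at isCont_def del: phi_p_0)
  \<comment> \<open>At 0 the difference quotient of the p-th power is \<open>phi_p\<close> itself,
    so differentiability there reduces to continuity of \<open>phi_p\<close>.\<close>
  moreover have "(\<lambda>h. (\<bar>0 + h\<bar> powr p - \<bar>0\<bar> powr p) / h) = phi_p p"
    by (rule ext) (simp add: phi_p_times_self[symmetric])
  ultimately have "((\<lambda>h. (\<bar>0 + h\<bar> powr p - \<bar>0\<bar> powr p) / h) \<longlongrightarrow> 0) (at 0)"
    by simp
  then show ?thesis
    by (simp add: DERIV_def equal)
qed

lemma DERIV_abs_powr_compose [derivative_intros]:
  "p > 1 \<Longrightarrow> (f has_real_derivative D) (at x within S) \<Longrightarrow>
    ((\<lambda>x. \<bar>f x\<bar> powr p) has_real_derivative p * phi_p p (f x) * D) (at x within S)"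
  by (rule DERIV_chain2[OF DERIV_abs_powr])

lemma continuous_on_abs_powr [continuous_intros]:
  "p > 0 \<Longrightarrow> continuous_on S f \<Longrightarrow> continuous_on S (\<lambda>x. \<bar>f x :: real\<bar> powr (p::real))"
  by (intro continuous_on_powr' continuous_intros) auto

text \<open>Strict convexity: since \<open>phi_p p t * t = \<bar>t\<bar> powr p\<close>, the left
  side is the tangent to the p-th power at t, evaluated at s. The nonstrict form is the pointwise
  Picone inequality; the strict form settles its equality case.\<close>

lemma abs_powr_tangent_strict:
  assumes "p > 1" "s \<noteq> t"
  shows "p * phi_p p t * s - (p - 1) * \<bar>t\<bar> powr p < \<bar>s\<bar> powr p"
proof -
  define h where "h x = \<bar>x\<bar> powr p - p * phi_p p t * x" for x
  have D: "(h has_real_derivative p * (phi_p p x - phi_p p t)) (at x)" for x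
    unfolding h_def using assms by (auto intro!: derivative_eq_intros simp: algebra_simps)
  have "h t < h s"
  proof (cases "t < s")
    case True
    from MVT2[OF True D] obtain z where z: "t < z" "h s - h t = (s - t) * (p * (phi_p p z - phi_p p t))"
      by auto
    moreover have "(s - t) * (p * (phi_p p z - phi_p p t)) > 0"
      using True assms phi_p_strict_mono[OF assms(1) z(1)] by simp
    ultimately show ?thesis by simp
  next
    case False
    with assms have "s < t" by simp
    from MVT2[OF this D] obtain z where z: "z < t" "h t - h s = (t - s) * (p * (phi_p p z - phi_p p t))"
      by auto
    moreover have "(t - s) * (p * (phi_p p z - phi_p p t)) < 0"
      using \<open>s < t\<close> assms phi_p_strict_mono[OF assms(1) z(1)] by (simp add: mult_pos_neg)
    ultimately show ?thesis by simp
  qed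
  then show ?thesis
    using phi_p_times_self[of p t] by (simp add: h_def algebra_simps)
qed

lemma abs_powr_tangent:
  assumes "p > 1"
  shows "p * phi_p p t * s - (p - 1) * \<bar>t\<bar> powr p \<le> \<bar>s\<bar> powr p"
  using abs_powr_tangent_strict[OF assms, of s t] phi_p_times_self[of p t]
  by (cases "s = t") (auto simp: algebra_simps)

lemma continuous_on_Icc_bound:
  fixes f :: "real \<Rightarrow> real"
  assumes "continuous_on {a..b} f"
  obtains M where "\<And>x. x \<in> {a..b} \<Longrightarrow> \<bar>f x\<bar> \<le> M"
proof -
  have "compact (f ` {a..b})"
    using assms compact_continuous_image compact_Icc by blast
  then show ?thesis
    using that by (metis compact_imp_bounded bounded_iff imageI real_norm_def)
qed

subsection \<open>Periodic solutions and their zeros\<close>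

text \<open>The coefficient \<open>c\<close> stands for q - lambda m. Being merely continuous, with
  no sign condition, it lets the arguments about the differential equation ignore the origin of the
  two terms.\<close>

locale periodic_solution =
  fixes T p :: real and c u u' :: "real \<Rightarrow> real"
  assumes T_pos: "T > 0" and p_gt_1: "p > 1"
    and cont_c: "continuous_on {0..T} c"
    and cont_u': "continuous_on {0..T} u'"
    and deriv_u: "x \<in> {0..T} \<Longrightarrow> (u has_real_derivative u' x) (at x within {0..T})"
    and deriv_flux: "x \<in> {0<..<T} \<Longrightarrow>
      ((\<lambda>y. phi_p p (u' y)) has_real_derivative c x * phi_p p (u x)) (at x)"
    and periodic: "u 0 = u T" "u' 0 = u' T"
begin

lemma minus: "periodic_solution T p c (\<lambda>x. - u x) (\<lambda>x. - u' x)"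
proof
  fix x assume "x \<in> {0<..<T}"
  from DERIV_minus[OF deriv_flux[OF this]]
  show "((\<lambda>y. phi_p p (- u' y)) has_real_derivative c x * phi_p p (- u x)) (at x)" by simp
qed (use T_pos p_gt_1 cont_c cont_u' periodic in
    \<open>auto intro!: continuous_intros DERIV_minus deriv_u\<close>)

lemma cont_u: "continuous_on {0..T} u"
  using deriv_u by (meson DERIV_continuous continuous_on_eq_continuous_within)

lemma deriv_u_interior: "x \<in> {0<..<T} \<Longrightarrow> (u has_real_derivative u' x) (at x)"
  using deriv_u[of x] at_within_Icc_at[of 0 x T] by auto

lemma flux_increment:
  assumes "0 \<le> a" "a \<le> b" "b \<le> T"
  shows "((\<lambda>x. c x * phi_p p (u x)) has_integral phi_p p (u' b) - phi_p p (u' a)) {a..b}"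
proof (rule fundamental_theorem_of_calculus_interior[OF assms(2)])
  show "continuous_on {a..b} (\<lambda>x. phi_p p (u' x))"
    using assms by (intro continuous_intros p_gt_1 continuous_on_subset[OF cont_u']) auto
qed (use assms deriv_flux in \<open>auto simp: has_real_derivative_iff_has_vector_derivative[symmetric]\<close>)

text \<open>This is the equation tested with u itself. The boundary terms cancel over a full period
  by periodicity, and over a nodal interval because u vanishes at both ends.\<close>

lemma energy_identity:
  assumes "0 \<le> a" "a \<le> b" "b \<le> T"
  shows "((\<lambda>x. \<bar>u' x\<bar> powr p + c x * \<bar>u x\<bar> powr p) has_integral
    phi_p p (u' b) * u b - phi_p p (u' a) * u a) {a..b}"
proof (rule fundamental_theorem_of_calculus_interior[OF assms(2)])
  show "continuous_on {a..b} (\<lambda>x. phi_p p (u' x) * u x)"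
    using assms by (intro continuous_intros p_gt_1 continuous_on_subset[OF cont_u']
        continuous_on_subset[OF cont_u]) auto
  show "((\<lambda>x. phi_p p (u' x) * u x) has_vector_derivative \<bar>u' x\<bar> powr p + c x * \<bar>u x\<bar> powr p) (at x)"
    if "x \<in> {a<..<b}" for x
    unfolding has_real_derivative_iff_has_vector_derivative[symmetric]
      phi_p_times_self[symmetric]
    using that assms
    by (auto intro!: derivative_eq_intros deriv_u_interior deriv_flux simp: algebra_simps)
qed

text \<open>
  On an interval of length \<open>\<delta>\<close> starting at a double zero, \<open>N = max \<bar>u'\<bar>\<close> satisfies \<open>\<bar>u\<bar> \<le> N \<delta>\<close>, hence by the
  equation \<open>N\<^sup>p\<^sup>-\<^sup>1 \<le> C \<delta>\<^sup>p N\<^sup>p\<^sup>-\<^sup>1\<close>. This forces \<open>N = 0\<close> for small \<open>\<delta>\<close>, although the equation may be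
  degenerate or non-Lipschitz there.
\<close>

lemma double_zero_local:
  assumes C: "\<And>x. x \<in> {0..T} \<Longrightarrow> \<bar>c x\<bar> \<le> C"
    and \<delta>: "0 < \<delta>" "C * \<delta> powr p < 1"
    and z: "z \<in> {0..T}" "u z = 0" "u' z = 0"
    and x: "x \<in> {0..T}" "\<bar>x - z\<bar> \<le> \<delta>"
  shows "u x = 0 \<and> u' x = 0"
proof -
  define I where "I = {max 0 (z - \<delta>)..min T (z + \<delta>)}"
  have I: "I \<subseteq> {0..T}" "x \<in> I" "z \<in> I" "compact I" "convex I" "\<And>y. y \<in> I \<Longrightarrow> \<bar>y - z\<bar> \<le> \<delta>"
    using z x \<delta> by (auto simp: I_def)
  have "continuous_on I (\<lambda>y. \<bar>u' y\<bar>)"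
    by (intro continuous_intros continuous_on_subset[OF cont_u' I(1)])
  with I obtain y where y: "y \<in> I" "\<And>t. t \<in> I \<Longrightarrow> \<bar>u' t\<bar> \<le> \<bar>u' y\<bar>"
    using continuous_attains_sup[of I "\<lambda>y. \<bar>u' y\<bar>"] by blast
  define N where "N = \<bar>u' y\<bar>"
  have N: "\<bar>u' t\<bar> \<le> N" if "t \<in> I" for t
    using y that by (simp add: N_def)
  have u_le: "\<bar>u t\<bar> \<le> N * \<delta>" if "t \<in> I" for t
  proof -
    have "norm (u t - u z) \<le> N * norm (t - z)"
    proof (rule field_differentiable_bound[OF I(5)])
      show "(u has_field_derivative u' s) (at s within I)" if "s \<in> I" for s
        using that I(1) by (intro DERIV_subset[OF deriv_u]) auto
    qed (use that I N in auto)
    also have "\<dots> \<le> N * \<delta>"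
      using I(6)[OF that] by (intro mult_left_mono) (auto simp: N_def)
    finally show ?thesis using z by simp
  qed
  have C0: "C \<ge> 0" using C[OF z(1)] by linarith
  have flux_le: "\<bar>c t * phi_p p (u t)\<bar> \<le> C * (N * \<delta>) powr (p - 1)" if "t \<in> I" for t
    unfolding abs_mult abs_phi_p
    using that I(1) C u_le[OF that] p_gt_1 C0
    by (intro mult_mono powr_mono2) auto
  define l r where "l = min y z" and "r = max y z"
  have lr: "0 \<le> l" "l \<le> r" "r \<le> T" "{l..r} \<subseteq> I" "r - l \<le> \<delta>"
    using y(1) I(1,3,6) z(1) unfolding l_def r_def I_def by (auto simp: abs_if split: if_splits)
  have "\<bar>phi_p p (u' r) - phi_p p (u' l)\<bar> \<le> (C * (N * \<delta>) powr (p - 1)) * (r - l)"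
    using has_integral_bound_real[OF _ _ flux_increment[OF lr(1-3)], of "C * (N * \<delta>) powr (p - 1)" "{}"]
      flux_le lr(2,4) C0 by (auto simp: subset_iff)
  also have "\<dots> \<le> (C * (N * \<delta>) powr (p - 1)) * \<delta>"
    using lr C0 by (intro mult_left_mono) auto
  also have "\<dots> = (C * \<delta> powr p) * N powr (p - 1)"
  proof -
    have "\<delta> powr p = \<delta> powr (p - 1) * \<delta>"
      using \<delta>(1) powr_add[of \<delta> "p - 1" 1] by simp
    then show ?thesis using \<delta>(1) by (simp add: powr_mult N_def)
  qed
  finally have le: "\<bar>phi_p p (u' r) - phi_p p (u' l)\<bar> \<le> (C * \<delta> powr p) * N powr (p - 1)" .
  \<comment> \<open>One of \<open>l\<close>, \<open>r\<close> is the double zero z, where the flux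
    is 0; the other is the point y at which the maximum N is attained.\<close>
  have "\<bar>phi_p p (u' r) - phi_p p (u' l)\<bar> = N powr (p - 1)"
    using z(3) by (auto simp: l_def r_def N_def abs_phi_p min_def max_def)
  with le have "N powr (p - 1) * (1 - C * \<delta> powr p) \<le> 0"
    by (simp add: algebra_simps)
  then have "N powr (p - 1) \<le> 0"
    using \<delta>(2) by (simp add: mult_le_0_iff)
  then have "N = 0" by simp
  with N[OF I(2)] u_le[OF I(2)] show ?thesis by simp
qed

text \<open>The admissible \<open>\<delta>\<close> depends only on a bound for c, not on z. The
  double zero therefore spreads in steps of equal length and reaches any point after finitely
  many.\<close>

lemma double_zero_trivial:
  assumes z: "z \<in> {0..T}" "u z = 0" "u' z = 0" and x: "x \<in> {0..T}"
  shows "u x = 0"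
proof -
  obtain C0 where "\<And>x. x \<in> {0..T} \<Longrightarrow> \<bar>c x\<bar> \<le> C0"
    using continuous_on_Icc_bound[OF cont_c] by blast
  then have C: "\<And>x. x \<in> {0..T} \<Longrightarrow> \<bar>c x\<bar> \<le> \<bar>C0\<bar> + 1" by force
  \<comment> \<open>Chosen so that the bound for c times \<open>\<delta> powr p\<close> is 1/2,
    below the threshold 1 of the local lemma.\<close>
  define s where "s = 1 / (2 * (\<bar>C0\<bar> + 1))"
  define \<delta> where "\<delta> = s powr (1 / p)"
  have s: "s > 0" "(\<bar>C0\<bar> + 1) * s < 1" by (simp_all add: s_def)
  have "\<delta> powr p = s"
    using p_gt_1 s(1) by (simp add: \<delta>_def powr_powr)
  with s have \<delta>: "\<delta> > 0" "(\<bar>C0\<bar> + 1) * \<delta> powr p < 1"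
    by (simp_all add: \<delta>_def)
  have *: "\<forall>x\<in>{0..T}. \<bar>x - z\<bar> \<le> real n * \<delta> \<longrightarrow> u x = 0 \<and> u' x = 0" for n
  proof (induction n)
    case 0
    then show ?case using z by auto
  next
    case (Suc n)
    show ?case
    proof (intro ballI impI)
      fix x assume x: "x \<in> {0..T}" "\<bar>x - z\<bar> \<le> real (Suc n) * \<delta>"
      \<comment> \<open>One step of length at most \<open>\<delta>\<close> from x towards z, without
        overshooting z.\<close>
      define y where "y = (if x > z then max z (x - \<delta>) else min z (x + \<delta>))"
      have "y \<in> {0..T}" "\<bar>y - z\<bar> \<le> real n * \<delta>" "\<bar>x - y\<bar> \<le> \<delta>"
        using x z(1) \<delta>(1) by (auto simp: y_def algebra_simps max_def min_def abs_if split: if_splits)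
      with Suc show "u x = 0 \<and> u' x = 0"
        using double_zero_local[OF C \<delta>, of y x] x by blast
    qed
  qed
  obtain n where "T / \<delta> < real n" using reals_Archimedean2 by blast
  then have "T \<le> real n * \<delta>" using \<delta>(1) by (simp add: field_simps)
  then have "\<bar>x - z\<bar> \<le> real n * \<delta>" using x z(1) by auto
  with * x show ?thesis by blast
qed

lemma deriv_nonneg_left_endpoint:
  assumes ab: "0 \<le> a" "a < b" "b \<le> T" and ge: "\<And>x. x \<in> {a<..<b} \<Longrightarrow> u a \<le> u x"
  shows "u' a \<ge> 0"
proof (rule ccontr)
  assume "\<not> u' a \<ge> 0"
  then obtain d where d: "d > 0" "\<And>h. h > 0 \<Longrightarrow> a + h \<in> {0..T} \<Longrightarrow> h < d \<Longrightarrow> u (a + h) < u a"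
    using has_real_derivative_neg_dec_right[OF deriv_u[of a]] ab by auto
  define h where "h = min d (b - a) / 2"
  have "0 < h" "h < b - a" "h < d" using ab d(1) by (auto simp: h_def)
  then show False using d(2)[of h] ge[of "a + h"] ab by force
qed

lemma deriv_nonpos_right_endpoint:
  assumes ab: "0 \<le> a" "a < b" "b \<le> T" and ge: "\<And>x. x \<in> {a<..<b} \<Longrightarrow> u b \<le> u x"
  shows "u' b \<le> 0"
proof (rule ccontr)
  assume "\<not> u' b \<le> 0"
  then obtain d where d: "d > 0" "\<And>h. h > 0 \<Longrightarrow> b - h \<in> {0..T} \<Longrightarrow> h < d \<Longrightarrow> u (b - h) < u b"
    using has_real_derivative_pos_inc_left[OF deriv_u[of b]] ab by auto
  define h where "h = min d (b - a) / 2"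
  have "0 < h" "h < b - a" "h < d" using ab d(1) by (auto simp: h_def)
  then show False using d(2)[of h] ge[of "b - h"] ab by force
qed

text \<open>A zero of a nonnegative solution is a minimum, hence a double zero. At the end points
  only one-sided derivatives exist: \<open>u' 0 \<ge> 0\<close> and \<open>u' T \<le> 0\<close>, and
  periodicity forces both to vanish.\<close>

lemma nonneg_imp_pos:
  assumes nn: "\<And>x. x \<in> {0..T} \<Longrightarrow> u x \<ge> 0" and nt: "nontrivial_on T u" and x: "x \<in> {0..T}"
  shows "u x > 0"
proof (rule ccontr)
  assume "\<not> u x > 0"
  with nn[OF x] have ux: "u x = 0" by simp
  have "\<exists>z\<in>{0..T}. u z = 0 \<and> u' z = 0"
  proof (cases "x \<in> {0<..<T}")
    case True
    have "u' x = 0"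
    proof (rule DERIV_local_min[OF deriv_u_interior[OF True], of "min x (T - x)"])
      show "\<forall>y. \<bar>x - y\<bar> < min x (T - x) \<longrightarrow> u x \<le> u y"
        using nn ux by (auto simp: abs_if split: if_splits)
    qed (use True in auto)
    then show ?thesis using ux x by blast
  next
    case False
    then have 0: "u 0 = 0" "u T = 0" using x ux periodic by fastforce+
    have "u' 0 \<ge> 0"
      using deriv_nonneg_left_endpoint[of 0 T] T_pos 0 nn by auto
    moreover have "u' T \<le> 0"
      using deriv_nonpos_right_endpoint[of 0 T] T_pos 0 nn by auto
    ultimately show ?thesis using periodic 0 T_pos by force
  qed
  then obtain z where "z \<in> {0..T}" "u z = 0" "u' z = 0" by blast
  then have "\<forall>x\<in>{0..T}. u x = 0" using double_zero_trivial by blast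
  with nt show False unfolding nontrivial_on_def by blast
qed

lemma nontrivial_cases:
  assumes nt: "nontrivial_on T u"
  obtains "\<And>x. x \<in> {0..T} \<Longrightarrow> u x > 0" | "\<And>x. x \<in> {0..T} \<Longrightarrow> u x < 0" | "changes_sign_on T u"
proof -
  interpret neg: periodic_solution T p c "\<lambda>x. - u x" "\<lambda>x. - u' x" by (rule minus)
  have nt': "nontrivial_on T (\<lambda>x. - u x)" using nt by (auto simp: nontrivial_on_def)
  show thesis
  proof (cases "changes_sign_on T u")
    case False
    then consider "\<forall>x\<in>{0..T}. u x \<ge> 0" | "\<forall>x\<in>{0..T}. - u x \<ge> 0"
      unfolding changes_sign_on_def by force
    then show ?thesis
    proof cases
      case 1
      then show ?thesis using nonneg_imp_pos[OF _ nt] that(1) by blast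
    next
      case 2
      then show ?thesis using neg.nonneg_imp_pos[OF _ nt'] that(2) by force
    qed
  qed (rule that(3))
qed

end

subsection \<open>One-dimensional Sobolev functions\<close>

lemma LINT_Ioo_eq_integral:
  fixes f :: "real \<Rightarrow> real"
  assumes "f absolutely_integrable_on {a..b}"
  shows "(LINT x:{a<..<b}|lebesgue. f x) = integral {a..b} f"
  using assms set_lebesgue_integral_eq_integral(2)[of "{a<..<b}" f]
  by (simp add: absolutely_integrable_on_Icc_iff_Ioo integral_open_interval_real)

lemma test_functionD:
  assumes "test_function T \<eta>"
  shows "(\<eta> has_real_derivative deriv \<eta> x) (at x)" "continuous_on S (deriv \<eta>)"
    "continuous_on S \<eta>" "\<eta> 0 = 0" "\<eta> T = 0"
proof -
  obtain D where D: "\<And>x. (\<eta> has_real_derivative D x) (at x)" "continuous_on UNIV D"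
    using assms by (auto simp: test_function_def C1_differentiable_on_def
        has_real_derivative_iff_has_vector_derivative)
  moreover from D(1) have "deriv \<eta> = D" by (auto intro: DERIV_imp_deriv)
  ultimately show "(\<eta> has_real_derivative deriv \<eta> x) (at x)" "continuous_on S (deriv \<eta>)"
    by (auto intro: continuous_on_subset)
  show "continuous_on S \<eta>"
    using D(1) by (meson DERIV_isCont continuous_at_imp_continuous_on)
  have "{x. \<eta> x \<noteq> 0} \<subseteq> {0<..<T}"
  proof (rule subset_trans[OF closure_subset])
    show "closure {x. \<eta> x \<noteq> 0} \<subseteq> {0<..<T}"
      using assms unfolding test_function_def by (elim conjE)
  qed
  then show "\<eta> 0 = 0" "\<eta> T = 0" by auto
qed

section \<open>Piecewise smooth functions as elements of the Sobolev space\<close>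

lemma in_Lp_I:
  assumes "f absolutely_integrable_on {0..T}" "(\<lambda>x. \<bar>f x\<bar> powr p) absolutely_integrable_on {0..T}"
  shows "in_Lp T p f"
  using assms unfolding in_Lp_def absolutely_integrable_on_Icc_iff_Ioo
  by (auto simp: set_integrable_def set_borel_measurable_def)

lemma absolutely_integrable_extend_0:
  fixes g :: "real \<Rightarrow> real"
  assumes "continuous_on {a..b} g"
  shows "(\<lambda>x. if x \<in> {a..b} then g x else 0) absolutely_integrable_on {c..d}"
proof -
  have "(\<lambda>x. if x \<in> {a..b} then g x else 0) absolutely_integrable_on UNIV"
    using absolutely_integrable_continuous_real[OF assms]
    by (subst absolutely_integrable_restrict_UNIV)
  then show ?thesis by (rule absolutely_integrable_on_subinterval) simp
qed

text \<open>Integrate the derivative of w times a test function. The fundamental theorem tolerates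
  the corners at a and b because w is continuous, and the boundary terms vanish with the test
  function.\<close>

lemma W1p_deriv_piecewise:
  assumes "p > 1" "T > 0" and w: "continuous_on {0..T} w" and g: "continuous_on {a..b} g"
    and v: "v = (\<lambda>x. if x \<in> {a..b} then g x else 0)"
    and D: "\<And>x. x \<in> {0<..<T} - {a, b} \<Longrightarrow> (w has_real_derivative v x) (at x)"
  shows "W1p_deriv T p w v"
proof -
  have vp: "(\<lambda>x. \<bar>v x\<bar> powr p) = (\<lambda>x. if x \<in> {a..b} then \<bar>g x\<bar> powr p else 0)"
    by (auto simp: v)
  have "in_Lp T p w"
    using assms(1) by (intro in_Lp_I absolutely_integrable_continuous_real continuous_intros w) auto
  moreover have "in_Lp T p v"
  proof (rule in_Lp_I)
    show "v absolutely_integrable_on {0..T}"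
      unfolding v by (rule absolutely_integrable_extend_0[OF g])
    show "(\<lambda>x. \<bar>v x\<bar> powr p) absolutely_integrable_on {0..T}"
      unfolding vp using assms(1) by (intro absolutely_integrable_extend_0 continuous_intros g) auto
  qed
  moreover have "weak_derivative T w v"
    unfolding weak_derivative_def
  proof (intro allI impI)
    fix \<eta> assume \<eta>: "test_function T \<eta>"
    note \<eta>D = test_functionD[OF \<eta>]
    have "((\<lambda>x. w x * deriv \<eta> x + v x * \<eta> x) has_integral w T * \<eta> T - w 0 * \<eta> 0) {0..T}"
    proof (rule fundamental_theorem_of_calculus_interior_strong[of "{a, b}"])
      show "((\<lambda>x. w x * \<eta> x) has_vector_derivative w x * deriv \<eta> x + v x * \<eta> x) (at x)"
        if "x \<in> {0<..<T} - {a, b}" for x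
        unfolding has_real_derivative_iff_has_vector_derivative[symmetric]
        by (rule derivative_eq_intros D[OF that] \<eta>D refl)+ simp
    qed (use assms in \<open>auto intro!: continuous_intros w \<eta>D\<close>)
    moreover have 1: "(\<lambda>x. w x * deriv \<eta> x) absolutely_integrable_on {0..T}"
      by (intro absolutely_integrable_continuous_real continuous_intros w \<eta>D)
    moreover have 2: "(\<lambda>x. v x * \<eta> x) absolutely_integrable_on {0..T}"
    proof -
      have "(\<lambda>x. v x * \<eta> x) = (\<lambda>x. if x \<in> {a..b} then g x * \<eta> x else 0)"
        by (auto simp: v)
      then show ?thesis
        by (simp only:) (intro absolutely_integrable_extend_0 continuous_intros g \<eta>D)
    qed
    ultimately have "integral {0..T} (\<lambda>x. w x * deriv \<eta> x) + integral {0..T} (\<lambda>x. v x * \<eta> x) = 0"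
      using \<eta>D by (subst integral_add[symmetric])
        (auto intro: set_lebesgue_integral_eq_integral(1) integral_unique)
    then show "(LINT x:{0<..<T}|lebesgue. w x * deriv \<eta> x) = - (LINT x:{0<..<T}|lebesgue. v x * \<eta> x)"
      by (simp add: LINT_Ioo_eq_integral 1 2)
  qed
  ultimately show ?thesis using w by (simp add: W1p_deriv_def)
qed

text \<open>Clamping the argument to [a,b] continues f by its end values, with corners only at a and
  b. The bump with positive mass and the cut-off of a solution to a nodal interval, shifted by t,
  both have this form.\<close>

lemma W1p_deriv_clamp:
  assumes "p > 1" "T > 0" and ab: "a \<le> b"
    and f: "continuous_on {a..b} f" and g: "continuous_on {a..b} g"
    and D: "\<And>x. x \<in> {a<..<b} \<Longrightarrow> (f has_real_derivative g x) (at x)"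
  shows "W1p_deriv T p (\<lambda>x. f (max a (min b x)) + t) (\<lambda>x. if x \<in> {a..b} then g x else 0)"
proof (rule W1p_deriv_piecewise[OF assms(1,2) _ g refl])
  show "continuous_on {0..T} (\<lambda>x. f (max a (min b x)) + t)"
    using ab by (intro continuous_intros continuous_on_compose2[OF f]) auto
  fix x assume "x \<in> {0<..<T} - {a, b}"
  then consider "x < a" | "x \<in> {a<..<b}" | "x > b" using ab by force
  then show "((\<lambda>x. f (max a (min b x)) + t) has_real_derivative
      (if x \<in> {a..b} then g x else 0)) (at x)"
  proof cases
    case 1
    have "((\<lambda>x. f a + t) has_real_derivative (if x \<in> {a..b} then g x else 0)) (at x)"
      using 1 by simp
    then show ?thesis
    proof (rule has_field_derivative_transform_within_open[where S = "{..<a}"])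
      show "f a + t = f (max a (min b y)) + t" if "y \<in> {..<a}" for y
        using that by (simp add: max_def min_def)
    qed (use 1 in simp_all)
  next
    case 2
    from DERIV_add[OF D[OF 2] DERIV_const[of t]]
    have "((\<lambda>x. f x + t) has_real_derivative (if x \<in> {a..b} then g x else 0)) (at x)"
      using 2 by simp
    then show ?thesis
    proof (rule has_field_derivative_transform_within_open[where S = "{a<..<b}"])
      show "f y + t = f (max a (min b y)) + t" if "y \<in> {a<..<b}" for y
        using that by (simp add: max_def min_def)
    qed (use 2 in simp_all)
  next
    case 3
    have "((\<lambda>x. f b + t) has_real_derivative (if x \<in> {a..b} then g x else 0)) (at x)"
      using 3 by simp
    then show ?thesis
    proof (rule has_field_derivative_transform_within_open[where S = "{b<..}"])
      show "f b + t = f (max a (min b y)) + t" if "y \<in> {b<..}" for y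
        using that ab by (simp add: max_def min_def)
    qed (use 3 in simp_all)
  qed
qed

lemma W1p_deriv_scale:
  assumes "W1p_deriv T p w v"
  shows "W1p_deriv T p (\<lambda>x. k * w x) (\<lambda>x. k * v x)"
proof -
  have in_Lp: "in_Lp T p (\<lambda>x. k * f x)" if "in_Lp T p f" for f
    using that unfolding in_Lp_def abs_mult powr_mult
    by (auto simp: set_borel_measurable_def intro!: set_integrable_mult_right)
       (auto simp: mult.left_commute[of _ k])
  show ?thesis
    using assms unfolding W1p_deriv_def weak_derivative_def
    by (auto intro!: in_Lp continuous_intros simp: mult.assoc)
qed

text \<open>On a bounded interval L^p is contained in L^1, because |s| is at most 1 + |s|^p.\<close>

lemma W1p_abs_integrable:
  assumes "p > 1" "W1p_deriv T p w v"
  shows "v absolutely_integrable_on {0..T}" "(\<lambda>x. \<bar>v x\<bar> powr p) absolutely_integrable_on {0..T}"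
proof -
  from assms have v: "set_borel_measurable lebesgue {0<..<T} v"
    and vp: "(\<lambda>x. \<bar>v x\<bar> powr p) absolutely_integrable_on {0<..<T}"
    by (auto simp: W1p_deriv_def in_Lp_def)
  show "(\<lambda>x. \<bar>v x\<bar> powr p) absolutely_integrable_on {0..T}"
    using vp by (simp add: absolutely_integrable_on_Icc_iff_Ioo)
  have "v absolutely_integrable_on {0<..<T}"
  proof (rule set_integrable_bound)
    show "(\<lambda>x. 1 + \<bar>v x\<bar> powr p) absolutely_integrable_on {0<..<T}"
      by (intro set_integral_add vp) (simp flip: absolutely_integrable_on_Icc_iff_Ioo)
    have "\<bar>s\<bar> \<le> 1 + \<bar>s\<bar> powr p" for s :: real
      using assms(1) powr_mono[of 1 p "\<bar>s\<bar>"] by (cases "\<bar>s\<bar> \<le> 1") (auto intro: add_increasing2)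
    then show "AE x in lebesgue. x \<in> {0<..<T} \<longrightarrow> norm (v x) \<le> norm (1 + \<bar>v x\<bar> powr p)"
      by (auto simp: add_nonneg_nonneg)
  qed (rule v)
  then show "v absolutely_integrable_on {0..T}"
    by (simp add: absolutely_integrable_on_Icc_iff_Ioo)
qed

section \<open>Test functions built from a quadratic spline\<close>

text \<open>A \<open>C\<^sup>1\<close> transition from 0 on \<open>t \<le> 0\<close> to 1 on \<open>t \<ge> 1\<close>, as a quadratic spline, and its derivative.\<close>

definition smooth_step :: "real \<Rightarrow> real" where
  "smooth_step t = 2 * (max 0 t)\<^sup>2 - 4 * (max 0 (t - 1 / 2))\<^sup>2 + 2 * (max 0 (t - 1))\<^sup>2"

definition hat :: "real \<Rightarrow> real" where
  "hat t = 4 * max 0 t - 8 * max 0 (t - 1 / 2) + 4 * max 0 (t - 1)"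

lemma DERIV_max_0_squared:
  "((\<lambda>t. (max 0 t)\<^sup>2) has_real_derivative 2 * max 0 s) (at (s::real))"
proof (cases s "0::real" rule: linorder_cases)
  case less
  have "((\<lambda>_. 0) has_real_derivative 2 * max 0 s) (at s)" using less by simp
  then show ?thesis
    by (rule has_field_derivative_transform_within_open[where S = "{..<0}"]) (use less in auto)
next
  case greater
  have "((\<lambda>t. t\<^sup>2) has_real_derivative 2 * max 0 s) (at s)"
    using greater by (auto intro!: derivative_eq_intros)
  then show ?thesis
    by (rule has_field_derivative_transform_within_open[where S = "{0<..}"]) (use greater in auto)
next
  case equal
  have "(max 0 \<longlongrightarrow> 0) (at (0::real))"
    by (rule tendsto_eq_intros | simp)+
  moreover have "(\<lambda>h::real. ((max 0 (0 + h))\<^sup>2 - (max 0 0)\<^sup>2) / h) = max 0"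
    by (rule ext) (simp add: max_def power2_eq_square)
  ultimately have "((\<lambda>h::real. ((max 0 (0 + h))\<^sup>2 - (max 0 0)\<^sup>2) / h) \<longlongrightarrow> 0) (at 0)"
    by (simp only:)
  then show ?thesis by (simp add: DERIV_def equal)
qed

lemma DERIV_smooth_step: "(smooth_step has_real_derivative hat t) (at t)"
proof -
  have D: "((\<lambda>t. k * (max 0 (t - a))\<^sup>2) has_real_derivative k * (2 * max 0 (t - a))) (at t)" for k a
  proof -
    have "((\<lambda>t. t - a) has_real_derivative 1) (at t)"
      by (auto intro!: derivative_eq_intros)
    from DERIV_cmult[OF DERIV_chain2[OF DERIV_max_0_squared this], of k] show ?thesis by simp
  qed
  show ?thesis
    unfolding smooth_step_def[abs_def] hat_def
    using DERIV_add[OF DERIV_diff[OF D[of 2 0] D[of 4 "1/2"]] D[of 2 1]] by simp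
qed

lemma DERIV_smooth_step_scaled:
  "((\<lambda>t. smooth_step ((t - x) / \<epsilon>)) has_real_derivative hat ((t - x) / \<epsilon>) / \<epsilon>) (at t within S)"
proof -
  have "((\<lambda>t. (t - x) / \<epsilon>) has_real_derivative 1 / \<epsilon>) (at t within S)"
    unfolding divide_inverse by (auto intro!: derivative_eq_intros)
  from DERIV_chain2[OF DERIV_smooth_step this] show ?thesis by simp
qed

lemma continuous_on_hat [continuous_intros]:
  "continuous_on S f \<Longrightarrow> continuous_on S (\<lambda>x. hat (f x))"
  unfolding hat_def by (intro continuous_intros)

lemma hat_nonneg: "hat t \<ge> 0"
  by (auto simp: hat_def max_def)

lemma hat_eq_0: "t \<le> 0 \<or> t \<ge> 1 \<Longrightarrow> hat t = 0"
  by (auto simp: hat_def max_def)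

lemma smooth_step_eq_0: "t \<le> 0 \<Longrightarrow> smooth_step t = 0"
  by (auto simp: smooth_step_def)

lemma smooth_step_eq_1: "t \<ge> 1 \<Longrightarrow> smooth_step t = 1"
  by (auto simp: smooth_step_def max_def power2_eq_square algebra_simps)

lemma smooth_step_bounds: "0 \<le> smooth_step t" "smooth_step t \<le> 1"
proof -
  have mono: "smooth_step s \<le> smooth_step t" if "s \<le> t" for s t
    by (rule DERIV_nonneg_imp_nondecreasing[OF that]) (use DERIV_smooth_step hat_nonneg in blast)
  show "0 \<le> smooth_step t"
    using mono[of "min 0 t" t] smooth_step_eq_0[of "min 0 t"] by simp
  show "smooth_step t \<le> 1"
    using mono[of t "max 1 t"] smooth_step_eq_1[of "max 1 t"] by simp
qed

lemma hat_scaled_has_integral: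
  assumes "\<epsilon> > 0" "0 \<le> x" "x + \<epsilon> \<le> T"
  shows "((\<lambda>t. hat ((t - x) / \<epsilon>) / \<epsilon>) has_integral 1) {0..T}"
proof -
  have "((\<lambda>t. hat ((t - x) / \<epsilon>) / \<epsilon>) has_integral
      smooth_step ((T - x) / \<epsilon>) - smooth_step ((0 - x) / \<epsilon>)) {0..T}"
    using assms
    by (intro fundamental_theorem_of_calculus)
       (auto simp flip: has_real_derivative_iff_has_vector_derivative
         intro: DERIV_smooth_step_scaled)
  then show ?thesis
    using assms by (simp add: smooth_step_eq_0 smooth_step_eq_1 divide_nonpos_pos)
qed

text \<open>The rescaled hats are nonnegative, have integral 1 and live on
  [x, x + \<open>\<epsilon> n\<close>]. They form an approximate identity at x from the
  right.\<close>

lemma hat_scaled_concentrates: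
  fixes w :: "real \<Rightarrow> real"
  assumes w: "continuous_on {0..T} w" and x: "0 \<le> x" "x + r \<le> T"
    and \<epsilon>: "\<epsilon> \<longlonglongrightarrow> 0" "\<And>n. 0 < \<epsilon> n" "\<And>n. \<epsilon> n \<le> r"
  shows "(\<lambda>n. integral {0..T} (\<lambda>t. w t * (hat ((t - x) / \<epsilon> n) / \<epsilon> n))) \<longlonglongrightarrow> w x"
proof (rule LIMSEQ_I)
  fix e :: real assume "e > 0"
  have xT: "x \<in> {0..T}" using x \<epsilon>(2,3)[of 0] by auto
  obtain d where d: "d > 0" "\<And>t. t \<in> {0..T} \<Longrightarrow> \<bar>t - x\<bar> < d \<Longrightarrow> \<bar>w t - w x\<bar> < e / 2"
    using w[unfolded continuous_on_iff, rule_format, OF xT, of "e / 2"] \<open>e > 0\<close>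
    by (auto simp: dist_real_def)
  obtain n0 where n0: "\<And>n. n \<ge> n0 \<Longrightarrow> \<epsilon> n < d"
    using order_tendstoD(2)[OF \<epsilon>(1) d(1)] by (auto simp: eventually_sequentially)
  show "\<exists>n0. \<forall>n\<ge>n0. norm (integral {0..T} (\<lambda>t. w t * (hat ((t - x) / \<epsilon> n) / \<epsilon> n)) - w x) < e"
  proof (intro exI allI impI)
    fix n assume n: "n \<ge> n0"
    define k where "k t = hat ((t - x) / \<epsilon> n) / \<epsilon> n" for t
    have "x + \<epsilon> n \<le> T" using x \<epsilon>(3)[of n] by linarith
    then have k1: "(k has_integral 1) {0..T}"
      unfolding k_def by (intro hat_scaled_has_integral \<epsilon> x)
    have "(\<lambda>t. w t * k t) integrable_on {0..T}"
      unfolding k_def using \<epsilon>(2)[of n] by (intro integrable_continuous_real continuous_intros w) auto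
    then have "((\<lambda>t. w t * k t) has_integral integral {0..T} (\<lambda>t. w t * k t)) {0..T}"
      by (rule integrable_integral)
    from has_integral_diff[OF this has_integral_mult_right[OF k1, of "w x"]]
    have *: "((\<lambda>t. (w t - w x) * k t) has_integral integral {0..T} (\<lambda>t. w t * k t) - w x) {0..T}"
      by (simp add: algebra_simps)
    have le: "norm ((w t - w x) * k t) \<le> e / 2 * k t" if "t \<in> {0..T}" for t
    proof (cases "x < t \<and> t < x + \<epsilon> n")
      case True
      then have "\<bar>w t - w x\<bar> \<le> e / 2" using d(2)[OF that] n0[OF n] by force
      moreover have "k t \<ge> 0"
        using \<epsilon>(2)[of n] by (simp add: k_def hat_nonneg)
      ultimately show ?thesis
        using mult_right_mono by (fastforce simp: abs_mult)
    next
      case False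
      then have "(t - x) / \<epsilon> n \<le> 0 \<or> (t - x) / \<epsilon> n \<ge> 1"
        using \<epsilon>(2)[of n] by (auto simp: field_simps)
      then show ?thesis by (simp add: k_def hat_eq_0)
    qed
    have "norm (integral {0..T} (\<lambda>t. (w t - w x) * k t)) \<le> integral {0..T} (\<lambda>t. e / 2 * k t)"
      using * has_integral_mult_right[OF k1] le by (intro integral_norm_bound_integral) auto
    also have "\<dots> = e / 2"
      using integral_unique[OF k1] by simp
    finally have "norm (integral {0..T} (\<lambda>t. w t * k t) - w x) < e"
      unfolding integral_unique[OF *] using \<open>e > 0\<close> by linarith
    then show "norm (integral {0..T} (\<lambda>t. w t * (hat ((t - x) / \<epsilon> n) / \<epsilon> n)) - w x) < e"
      unfolding k_def .
  qed
qed

text \<open>The function rises on [x, x + \<open>\<epsilon>\<close>] and falls on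
  [y, y + \<open>\<epsilon>\<close>]. Its derivative is a difference of two unit hats, so testing
  against it compares averages of w near x and near y.\<close>

lemma test_function_plateau:
  assumes "0 < x" "x \<le> y" "y + \<epsilon> < T" "\<epsilon> > 0"
  defines "\<eta> \<equiv> \<lambda>t. smooth_step ((t - x) / \<epsilon>) - smooth_step ((t - y) / \<epsilon>)"
  shows "test_function T \<eta>"
    "deriv \<eta> = (\<lambda>t. hat ((t - x) / \<epsilon>) / \<epsilon> - hat ((t - y) / \<epsilon>) / \<epsilon>)"
proof -
  have D: "(\<eta> has_real_derivative hat ((t - x) / \<epsilon>) / \<epsilon> - hat ((t - y) / \<epsilon>) / \<epsilon>) (at t)" for t
    unfolding \<eta>_def by (intro DERIV_diff DERIV_smooth_step_scaled)
  then show "deriv \<eta> = (\<lambda>t. hat ((t - x) / \<epsilon>) / \<epsilon> - hat ((t - y) / \<epsilon>) / \<epsilon>)"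
    by (auto intro: DERIV_imp_deriv)
  have C1: "\<eta> C1_differentiable_on UNIV"
    unfolding C1_differentiable_on_def has_real_derivative_iff_has_vector_derivative[symmetric]
    using D assms(4) by (intro exI[of _ "\<lambda>t. hat ((t - x) / \<epsilon>) / \<epsilon> - hat ((t - y) / \<epsilon>) / \<epsilon>"])
      (auto intro!: continuous_intros)
  have "{t. \<eta> t \<noteq> 0} \<subseteq> {x..y + \<epsilon>}"
  proof
    fix t assume t: "t \<in> {t. \<eta> t \<noteq> 0}"
    have False if "t < x"
      using that t assms by (simp add: smooth_step_eq_0 divide_nonpos_pos)
    moreover have False if "t > y + \<epsilon>"
      using that t assms by (simp add: smooth_step_eq_1)
    ultimately show "t \<in> {x..y + \<epsilon>}" by force
  qed
  then have supp: "closure {t. \<eta> t \<noteq> 0} \<subseteq> {x..y + \<epsilon>}"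
    by (simp add: closure_minimal)
  moreover from supp have "compact (closure {t. \<eta> t \<noteq> 0})"
    using bounded_subset[OF bounded_closed_interval supp] by (simp add: compact_eq_bounded_closed)
  ultimately show "test_function T \<eta>"
    unfolding test_function_def using C1 assms(1-4) by auto
qed

section \<open>The fundamental theorem of calculus for weak derivatives\<close>

lemma smooth_step_tendsto:
  assumes "\<epsilon> \<longlonglongrightarrow> 0" "\<And>n. 0 < \<epsilon> n"
  shows "(\<lambda>n. smooth_step ((t - x) / \<epsilon> n)) \<longlonglongrightarrow> (if x < t then 1 else 0)"
proof (cases "x < t")
  case True
  then have "\<forall>\<^sub>F n in sequentially. \<epsilon> n < t - x"
    using assms(1) by (intro order_tendstoD(2)[of \<epsilon> 0]) auto
  then have "\<forall>\<^sub>F n in sequentially. smooth_step ((t - x) / \<epsilon> n) = 1"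
    by (rule eventually_mono) (use assms(2) in \<open>auto intro!: smooth_step_eq_1\<close>)
  with True show ?thesis by (simp add: tendsto_eventually)
next
  case False
  then show ?thesis
    using assms(2) by (auto simp: smooth_step_eq_0 divide_nonpos_pos)
qed

text \<open>Let the ramps of the plateau shrink. The side with w tends to \<open>w x - w y\<close>
  by concentration of the hats; the side with v tends to the integral over (x,y] by dominated
  convergence, with \<open>\<bar>v t\<bar>\<close> as majorant.\<close>

lemma W1p_increment_interior:
  assumes "p > 1" and W: "W1p_deriv T p w v" and xy: "0 < x" "x \<le> y" "y < T"
  shows "w y - w x = integral {x..y} v"
proof -
  have w: "continuous_on {0..T} w" using W by (simp add: W1p_deriv_def)
  note v = W1p_abs_integrable(1)[OF assms(1) W]
  \<comment> \<open>The factor (T - y)/2 keeps the falling ramp, which ends at y +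
    \<open>\<epsilon> n\<close>, inside (0,T).\<close>
  define \<epsilon> where "\<epsilon> n = (T - y) / 2 * inverse (real (Suc n))" for n
  have \<epsilon>: "\<epsilon> \<longlonglongrightarrow> 0" "\<And>n. 0 < \<epsilon> n" "\<And>n. \<epsilon> n \<le> (T - y) / 2"
    unfolding \<epsilon>_def using xy tendsto_mult_right_zero[OF LIMSEQ_inverse_real_of_nat]
    by (auto intro!: mult_left_le simp: inverse_le_1_iff simp del: of_nat_Suc)
  define \<eta> where "\<eta> n t = smooth_step ((t - x) / \<epsilon> n) - smooth_step ((t - y) / \<epsilon> n)" for n t
  have \<eta>: "test_function T (\<eta> n)"
    "deriv (\<eta> n) = (\<lambda>t. hat ((t - x) / \<epsilon> n) / \<epsilon> n - hat ((t - y) / \<epsilon> n) / \<epsilon> n)" for n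
    using test_function_plateau[of x y "\<epsilon> n" T] xy \<epsilon>(2,3)[of n] by (auto simp: \<eta>_def[abs_def])
  have \<eta>1: "\<bar>\<eta> n t\<bar> \<le> 1" for n t
    using smooth_step_bounds[of "(t - x) / \<epsilon> n"] smooth_step_bounds[of "(t - y) / \<epsilon> n"]
    by (auto simp: \<eta>_def)
  have v\<eta>: "(\<lambda>t. \<eta> n t * v t) absolutely_integrable_on {0..T}" for n
  proof (rule absolutely_integrable_bounded_measurable_product_real[OF _ _ _ v])
    show "\<eta> n \<in> borel_measurable (lebesgue_on {0..T})"
      by (intro continuous_imp_measurable_on_sets_lebesgue test_functionD[OF \<eta>(1)]) auto
    show "bounded (\<eta> n ` {0..T})" using \<eta>1 by (auto simp: bounded_iff)
  qed auto
  have weak: "integral {0..T} (\<lambda>t. w t * deriv (\<eta> n) t) = - integral {0..T} (\<lambda>t. \<eta> n t * v t)" for n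
  proof -
    have "(\<lambda>t. w t * deriv (\<eta> n) t) absolutely_integrable_on {0..T}"
      by (intro absolutely_integrable_continuous_real continuous_intros w test_functionD(2)[OF \<eta>(1)])
    moreover have "(LINT x:{0<..<T}|lebesgue. w x * deriv (\<eta> n) x) =
        - (LINT x:{0<..<T}|lebesgue. v x * \<eta> n x)"
      using W \<eta>(1) by (simp add: W1p_deriv_def weak_derivative_def)
    ultimately show ?thesis
      using v\<eta>[of n] by (simp add: LINT_Ioo_eq_integral mult.commute)
  qed
  have int_hat: "(\<lambda>t. w t * (hat ((t - z) / \<epsilon> n) / \<epsilon> n)) integrable_on {0..T}" for z n
    using \<epsilon>(2)[of n] by (intro integrable_continuous_real continuous_intros w) auto
  have eq: "- integral {0..T} (\<lambda>t. \<eta> n t * v t) =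
      integral {0..T} (\<lambda>t. w t * (hat ((t - x) / \<epsilon> n) / \<epsilon> n)) -
      integral {0..T} (\<lambda>t. w t * (hat ((t - y) / \<epsilon> n) / \<epsilon> n))" for n
    unfolding weak[symmetric] \<eta>(2) right_diff_distrib by (intro integral_diff int_hat)
  have "x + (T - y) / 2 \<le> T" "y + (T - y) / 2 \<le> T"
    using xy by (simp_all add: field_simps)
  then have "(\<lambda>n. integral {0..T} (\<lambda>t. w t * (hat ((t - x) / \<epsilon> n) / \<epsilon> n)) -
      integral {0..T} (\<lambda>t. w t * (hat ((t - y) / \<epsilon> n) / \<epsilon> n))) \<longlonglongrightarrow> w x - w y"
    using xy by (intro tendsto_diff hat_scaled_concentrates[OF w _ _ \<epsilon>]) simp_all
  then have "(\<lambda>n. - integral {0..T} (\<lambda>t. \<eta> n t * v t)) \<longlonglongrightarrow> w x - w y"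
    unfolding eq .
  from tendsto_minus[OF this]
  have lim1: "(\<lambda>n. integral {0..T} (\<lambda>t. \<eta> n t * v t)) \<longlonglongrightarrow> - (w x - w y)"
    by simp
  have "(\<lambda>n. integral {0..T} (\<lambda>t. \<eta> n t * v t)) \<longlonglongrightarrow> 
      integral {0..T} (\<lambda>t. ((if x < t then 1 else 0) - (if y < t then 1 else 0)) * v t)"
  proof (rule dominated_convergence(2))
    show "(\<lambda>t. \<eta> n t * v t) integrable_on {0..T}" for n
      using v\<eta> by (rule set_lebesgue_integral_eq_integral(1))
    show "(\<lambda>t. \<bar>v t\<bar>) integrable_on {0..T}"
      using v by (auto simp: absolutely_integrable_on_def)
    show "norm (\<eta> n t * v t) \<le> \<bar>v t\<bar>" for n t
      using \<eta>1[of n t] by (simp add: abs_mult mult_left_le_one_le)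
    show "(\<lambda>n. \<eta> n t * v t) \<longlonglongrightarrow> ((if x < t then 1 else 0) - (if y < t then 1 else 0)) * v t" for t
      unfolding \<eta>_def by (intro tendsto_intros smooth_step_tendsto \<epsilon>)
  qed
  also have "integral {0..T} (\<lambda>t. ((if x < t then 1 else 0) - (if y < t then 1 else 0)) * v t) =
      integral {0..T} (\<lambda>t. if t \<in> {x<..y} then v t else 0)"
    using xy by (intro integral_cong) auto
  also have "\<dots> = integral ({x<..y} \<inter> {0..T}) v"
    by (rule Henstock_Kurzweil_Integration.integral_restrict_Int)
  also have "{x<..y} \<inter> {0..T} = {x<..y}"
    using xy by auto
  also have "integral {x<..y} v = integral {x..y} v"
    by (rule integral_spike_set) (rule negligible_subset[of "{x}"]; auto)+
  finally show ?thesis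
    using LIMSEQ_unique[OF lim1] by force
qed

text \<open>The interior case says that w minus the indefinite integral of v is constant on (0,T).
  By continuity it is constant up to the end points.\<close>

lemma W1p_increment:
  assumes "p > 1" "T > 0" and W: "W1p_deriv T p w v" and xy: "0 \<le> x" "x \<le> y" "y \<le> T"
  shows "(v has_integral w y - w x) {x..y}"
proof -
  have w: "continuous_on {0..T} w" using W by (simp add: W1p_deriv_def)
  have v: "v integrable_on {0..T}"
    using W1p_abs_integrable(1)[OF assms(1) W] by (rule set_lebesgue_integral_eq_integral(1))
  define F where "F t = w t - integral {0..t} v" for t
  have F: "continuous_on {0..T} F"
    unfolding F_def by (intro continuous_intros w indefinite_integral_continuous_1 v)
  have split: "integral {0..s} v + integral {s..t} v = integral {0..t} v" if "0 \<le> s" "s \<le> t" "t \<le> T" for s t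
    by (rule Henstock_Kurzweil_Integration.integral_combine) (use that in \<open>auto intro: integrable_on_subinterval[OF v]\<close>)
  have const: "F s = F t" if "s \<in> {0<..<T}" "t \<in> {0<..<T}" "s \<le> t" for s t
    using split[of s t] W1p_increment_interior[OF assms(1) W, of s t] that by (simp add: F_def)
  have "F t = F (T / 2)" if "t \<in> {0..T}" for t
  proof (rule continuous_constant_on_closure[of "{0<..<T}" F])
    show "continuous_on (closure {0<..<T}) F" using F assms(2) by simp
    show "F s = F (T / 2)" if "s \<in> {0<..<T}" for s
      using const[of s "T / 2"] const[of "T / 2" s] that assms(2) by (cases "s \<le> T / 2") auto
    show "t \<in> closure {0<..<T}" using that assms(2) by simp
  qed
  from this[of x] this[of y] have "F y = F x" using xy by auto
  then have "integral {x..y} v = w y - w x"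
    using split[of x y] xy by (simp add: F_def)
  moreover have "v integrable_on {x..y}"
    using xy by (intro integrable_on_subinterval[OF v]) auto
  ultimately show ?thesis by (simp add: has_integral_iff)
qed

text \<open>The local errors are measured by an integral of \<open>k\<close>, which is additive over
  adjacent intervals. They add up to at most e times the integral of \<open>k\<close> over [a,b],
  and e is arbitrary. No derivative of F occurs.\<close>

lemma has_integral_of_local_increments:
  fixes f k F :: "real \<Rightarrow> real"
  assumes "a \<le> b" and f: "f integrable_on {a..b}" and k: "k integrable_on {a..b}"
    and loc: "\<And>e. e > 0 \<Longrightarrow> \<exists>d>0. \<forall>x y. a \<le> x \<and> x \<le> y \<and> y \<le> b \<and> y - x < d \<longrightarrow>
      \<bar>F y - F x - integral {x..y} f\<bar> \<le> e * integral {x..y} k"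
  shows "(f has_integral F b - F a) {a..b}"
proof -
  have bound: "\<bar>F b - F a - integral {a..b} f\<bar> \<le> e * integral {a..b} k" if e: "e > 0" for e
  proof -
    from loc[OF e] obtain d where d: "d > 0" "\<And>x y. \<lbrakk>a \<le> x; x \<le> y; y \<le> b; y - x < d\<rbrakk> \<Longrightarrow>
      \<bar>F y - F x - integral {x..y} f\<bar> \<le> e * integral {x..y} k" by blast
    \<comment> \<open>The induction counts steps of length d/2, since the local estimate demands a
      length strictly below d.\<close>
    have *: "\<forall>y. a \<le> y \<and> y \<le> b \<and> y - a \<le> real n * (d / 2) \<longrightarrow>
      \<bar>F y - F a - integral {a..y} f\<bar> \<le> e * integral {a..y} k" for n
    proof (induction n)
      case 0
      show ?case using d(2)[of a a] d(1) by auto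
    next
      case (Suc n)
      show ?case
      proof (intro allI impI; elim conjE)
        fix y assume y: "a \<le> y" "y \<le> b" "y - a \<le> real (Suc n) * (d / 2)"
        define z where "z = max a (y - d / 2)"
        have z: "a \<le> z" "z \<le> y" "y - z < d" "z - a \<le> real n * (d / 2)"
          using y d(1) by (auto simp: z_def max_def field_simps)
        have comb: "integral {a..z} h + integral {z..y} h = integral {a..y} h" if "h integrable_on {a..b}"
          for h :: "real \<Rightarrow> real"
          by (rule Henstock_Kurzweil_Integration.integral_combine) (use z y in \<open>auto intro: integrable_on_subinterval[OF that]\<close>)
        have "e * integral {a..z} k + e * integral {z..y} k = e * integral {a..y} k"
          by (simp add: comb[OF k] flip: distrib_left)
        with comb[OF f] Suc[rule_format, of z] d(2)[of z y] z y
        show "\<bar>F y - F a - integral {a..y} f\<bar> \<le> e * integral {a..y} k"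
          by linarith
      qed
    qed
    obtain n where "(b - a) / (d / 2) < real n" using reals_Archimedean2 by blast
    then have "b - a \<le> real n * (d / 2)" using d(1) by (simp add: field_simps)
    with * assms(1) show ?thesis by blast
  qed
  have "\<bar>F b - F a - integral {a..b} f\<bar> \<le> 0"
  proof (rule field_le_epsilon)
    fix \<epsilon> :: real assume "\<epsilon> > 0"
    define I where "I = \<bar>integral {a..b} k\<bar>"
    have "\<bar>F b - F a - integral {a..b} f\<bar> \<le> \<epsilon> / (I + 1) * integral {a..b} k"
      using \<open>\<epsilon> > 0\<close> by (intro bound) (simp add: I_def)
    also have "\<dots> \<le> \<epsilon> / (I + 1) * (I + 1)"
      using \<open>\<epsilon> > 0\<close> by (intro mult_left_mono) (auto simp: I_def)
    also have "\<dots> = 0 + \<epsilon>" by (simp add: I_def)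
    finally show "\<bar>F b - F a - integral {a..b} f\<bar> \<le> 0 + \<epsilon>" .
  qed
  then show ?thesis using f by (simp add: has_integral_iff)
qed

text \<open>w itself need not be differentiable, so the mean value theorem is applied to the p-th
  power between the values \<open>w x\<close> and \<open>w y\<close>. The intermediate value theorem
  then realises the mean value as some \<open>w \<tau>\<close>.\<close>

lemma abs_powr_increment:
  fixes w :: "real \<Rightarrow> real"
  assumes "p > 1" "x \<le> y" "continuous_on {x..y} w"
  obtains \<tau> where "\<tau> \<in> {x..y}" "\<bar>w y\<bar> powr p - \<bar>w x\<bar> powr p = p * phi_p p (w \<tau>) * (w y - w x)"
proof (cases "w x" "w y" rule: linorder_cases)
  case less
  from MVT2[OF less DERIV_abs_powr[OF assms(1)]] obtain z where
    z: "w x < z" "z < w y" "\<bar>w y\<bar> powr p - \<bar>w x\<bar> powr p = (w y - w x) * (p * phi_p p z)" by auto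
  obtain \<tau> where "x \<le> \<tau>" "\<tau> \<le> y" "w \<tau> = z"
    using IVT'[of w x z y] z assms by auto
  with z that show ?thesis by (auto simp: mult.commute)
next
  case equal
  with that[of x] assms show ?thesis by simp
next
  case greater
  from MVT2[OF greater DERIV_abs_powr[OF assms(1)]] obtain z where
    z: "w y < z" "z < w x" "\<bar>w x\<bar> powr p - \<bar>w y\<bar> powr p = (w x - w y) * (p * phi_p p z)" by auto
  obtain \<tau> where "x \<le> \<tau>" "\<tau> \<le> y" "w \<tau> = z"
    using IVT2'[of w y z x] z assms by auto
  with z that[of \<tau>] show ?thesis by (auto simp: algebra_simps)
qed

lemma continuous_on_Icc_uniform:
  fixes f :: "real \<Rightarrow> real"
  assumes "continuous_on {a..b} f" "e > 0"
  obtains d where "d > 0" "\<And>x y. x \<in> {a..b} \<Longrightarrow> y \<in> {a..b} \<Longrightarrow> \<bar>x - y\<bar> < d \<Longrightarrow> \<bar>f x - f y\<bar> < e"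
  using compact_uniformly_continuous[OF assms(1) compact_Icc] assms(2)
  unfolding uniformly_continuous_on_def dist_real_def by metis

text \<open>Integrated product and chain rule for G |w|^p. On a short interval the increment is
  exactly the integral of an expression with frozen coefficients; uniform continuity bounds its
  distance to the true integrand by a small multiple of \<open>1 + \<bar>v t\<bar>\<close>.\<close>

lemma W1p_weighted_powr_has_integral:
  assumes "p > 1" "T > 0" and W: "W1p_deriv T p w v"
    and G: "continuous_on {0..T} G" and g: "continuous_on {0..T} g"
    and DG: "\<And>x. x \<in> {0<..<T} \<Longrightarrow> (G has_real_derivative g x) (at x)"
  shows "((\<lambda>x. g x * \<bar>w x\<bar> powr p + G x * (p * phi_p p (w x)) * v x) has_integral
    G T * \<bar>w T\<bar> powr p - G 0 * \<bar>w 0\<bar> powr p) {0..T}"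
proof -
  define A B where "A x = \<bar>w x\<bar> powr p" and "B x = p * phi_p p (w x)" for x
  have w: "continuous_on {0..T} w" using W by (simp add: W1p_deriv_def)
  have A: "continuous_on {0..T} A" and B: "continuous_on {0..T} B"
    unfolding A_def B_def using assms(1) by (intro continuous_intros w; simp)+
  note v = W1p_abs_integrable(1)[OF assms(1) W]
  have GBv: "(\<lambda>x. G x * B x * v x) absolutely_integrable_on {0..T}"
  proof (rule absolutely_integrable_bounded_measurable_product_real[OF _ _ _ v])
    have GB: "continuous_on {0..T} (\<lambda>x. G x * B x)" by (intro continuous_intros G B)
    then show "(\<lambda>x. G x * B x) \<in> borel_measurable (lebesgue_on {0..T})"
      by (intro continuous_imp_measurable_on_sets_lebesgue) auto
    show "bounded ((\<lambda>x. G x * B x) ` {0..T})"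
      by (intro compact_imp_bounded compact_continuous_image GB) auto
  qed auto
  have gA: "(\<lambda>x. g x * A x) integrable_on {0..T}"
    by (intro integrable_continuous_real continuous_intros g A)
  define f where "f x = g x * A x + G x * B x * v x" for x
  have f: "f integrable_on {0..T}"
    unfolding f_def by (intro integrable_add gA set_lebesgue_integral_eq_integral(1)[OF GBv])
  have k: "(\<lambda>x. 1 + \<bar>v x\<bar>) integrable_on {0..T}"
    using v by (auto simp: absolutely_integrable_on_def intro!: integrable_add)
  obtain M1 where M1: "\<And>x. x \<in> {0..T} \<Longrightarrow> \<bar>G x\<bar> \<le> M1" using continuous_on_Icc_bound[OF G] by blast
  obtain M2 where M2: "\<And>x. x \<in> {0..T} \<Longrightarrow> \<bar>g x\<bar> \<le> M2" using continuous_on_Icc_bound[OF g] by blast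
  obtain M3 where M3: "\<And>x. x \<in> {0..T} \<Longrightarrow> \<bar>B x\<bar> \<le> M3" using continuous_on_Icc_bound[OF B] by blast
  define M where "M = \<bar>M1\<bar> + \<bar>M2\<bar> + \<bar>M3\<bar> + 1"
  have M: "M > 0" "\<And>x. x \<in> {0..T} \<Longrightarrow> \<bar>G x\<bar> \<le> M" "\<And>x. x \<in> {0..T} \<Longrightarrow> \<bar>g x\<bar> \<le> M"
    "\<And>x. x \<in> {0..T} \<Longrightarrow> \<bar>B x\<bar> \<le> M"
    using M1 M2 M3 by (force simp: M_def)+
  have "(f has_integral G T * A T - G 0 * A 0) {0..T}"
  proof (rule has_integral_of_local_increments[OF _ f k])
    fix e :: real assume "e > 0"
    \<comment> \<open>The error found below is at most M e' + 2 M e' |v|, hence at most 2 M e' (1 +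
      |v|).\<close>
    define e' where "e' = e / (2 * M)"
    have e': "e' > 0" using \<open>e > 0\<close> M(1) by (simp add: e'_def)
    obtain d1 where d1: "d1 > 0" "\<And>x y. x \<in> {0..T} \<Longrightarrow> y \<in> {0..T} \<Longrightarrow> \<bar>x - y\<bar> < d1 \<Longrightarrow> \<bar>A x - A y\<bar> < e'"
      using continuous_on_Icc_uniform[OF A e'] by blast
    obtain d2 where d2: "d2 > 0" "\<And>x y. x \<in> {0..T} \<Longrightarrow> y \<in> {0..T} \<Longrightarrow> \<bar>x - y\<bar> < d2 \<Longrightarrow> \<bar>G x - G y\<bar> < e'"
      using continuous_on_Icc_uniform[OF G e'] by blast
    obtain d3 where d3: "d3 > 0" "\<And>x y. x \<in> {0..T} \<Longrightarrow> y \<in> {0..T} \<Longrightarrow> \<bar>x - y\<bar> < d3 \<Longrightarrow> \<bar>B x - B y\<bar> < e'"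
      using continuous_on_Icc_uniform[OF B e'] by blast
    define d where "d = min d1 (min d2 d3)"
    show "\<exists>d>0. \<forall>x y. 0 \<le> x \<and> x \<le> y \<and> y \<le> T \<and> y - x < d \<longrightarrow>
      \<bar>G y * A y - G x * A x - integral {x..y} f\<bar> \<le> e * integral {x..y} (\<lambda>x. 1 + \<bar>v x\<bar>)"
    proof (intro exI[of _ d] conjI allI impI; (elim conjE)?)
      show "d > 0" using d1 d2 d3 by (simp add: d_def)
      fix x y assume xy: "0 \<le> x" "x \<le> y" "y \<le> T" "y - x < d"
      have sub: "{x..y} \<subseteq> {0..T}" using xy by auto
      obtain \<tau> where \<tau>: "\<tau> \<in> {x..y}" "A y - A x = B \<tau> * (w y - w x)"
        using abs_powr_increment[OF assms(1) xy(2) continuous_on_subset[OF w sub]]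
        unfolding A_def B_def by blast
      have "(g has_integral G y - G x) {x..y}"
        using xy G
        by (intro fundamental_theorem_of_calculus_interior)
           (auto simp flip: has_real_derivative_iff_has_vector_derivative
             intro: DG continuous_on_subset)
      from has_integral_add[OF has_integral_mult_left[OF this, of "A y"]
          has_integral_mult_right[OF W1p_increment[OF assms(1,2) W xy(1-3)], of "G x * B \<tau>"]]
      have 1: "((\<lambda>t. g t * A y + G x * B \<tau> * v t) has_integral G y * A y - G x * A x) {x..y}"
      proof (rule has_integral_eq_rhs)
        have "G y * A y - G x * A x = (G y - G x) * A y + G x * (A y - A x)"
          by (simp add: algebra_simps)
        then show "G y * A y - G x * A x = (G y - G x) * A y + G x * B \<tau> * (w y - w x)"
          unfolding \<tau>(2) by simp
      qed
      have 2: "(f has_integral integral {x..y} f) {x..y}"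
        by (intro integrable_integral integrable_on_subinterval[OF f sub])
      have le: "norm ((g t * A y + G x * B \<tau> * v t) - f t) \<le> e * (1 + \<bar>v t\<bar>)" if t: "t \<in> {x..y}" for t
      proof -
        have in0T: "x \<in> {0..T}" "y \<in> {0..T}" "t \<in> {0..T}" "\<tau> \<in> {0..T}"
          using xy t \<tau>(1) by auto
        have close: "\<bar>A y - A t\<bar> \<le> e'" "\<bar>G x - G t\<bar> \<le> e'" "\<bar>B \<tau> - B t\<bar> \<le> e'"
          using xy(4) t \<tau>(1) d1(2)[of y t] d2(2)[of x t] d3(2)[of \<tau> t] in0T
          by (force simp: d_def)+
        have "(g t * A y + G x * B \<tau> * v t) - f t =
            g t * (A y - A t) + ((G x - G t) * B \<tau> + G t * (B \<tau> - B t)) * v t"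
          by (simp add: f_def algebra_simps)
        also have "\<bar>\<dots>\<bar> \<le> \<bar>g t\<bar> * \<bar>A y - A t\<bar> +
            (\<bar>G x - G t\<bar> * \<bar>B \<tau>\<bar> + \<bar>G t\<bar> * \<bar>B \<tau> - B t\<bar>) * \<bar>v t\<bar>"
        proof -
          have "\<bar>(G x - G t) * B \<tau> + G t * (B \<tau> - B t)\<bar> \<le>
              \<bar>G x - G t\<bar> * \<bar>B \<tau>\<bar> + \<bar>G t\<bar> * \<bar>B \<tau> - B t\<bar>"
            unfolding abs_mult[symmetric] by (rule abs_triangle_ineq)
          then show ?thesis
            by (intro order_trans[OF abs_triangle_ineq] add_mono)
               (auto simp: abs_mult intro!: mult_right_mono)
        qed
        also have "\<dots> \<le> M * e' + (e' * M + M * e') * \<bar>v t\<bar>"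
          using close M in0T e' by (intro add_mono mult_mono) auto
        also have "\<dots> \<le> (2 * M * e') * (1 + \<bar>v t\<bar>)"
          using e' M(1) by (simp add: algebra_simps)
        also have "2 * M * e' = e" using M(1) by (simp add: e'_def)
        finally show ?thesis by simp
      qed
      have "norm (integral {x..y} (\<lambda>t. (g t * A y + G x * B \<tau> * v t) - f t)) \<le>
          integral {x..y} (\<lambda>t. e * (1 + \<bar>v t\<bar>))"
        using has_integral_diff[OF 1 2] le integrable_on_subinterval[OF k sub]
        by (intro integral_norm_bound_integral) (auto intro!: integrable_on_mult_right)
      then show "\<bar>G y * A y - G x * A x - integral {x..y} f\<bar> \<le> e * integral {x..y} (\<lambda>x. 1 + \<bar>v x\<bar>)"
        using integral_unique[OF has_integral_diff[OF 1 2]] by simp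
    qed
  qed (use assms(2) in simp)
  then show ?thesis unfolding f_def A_def B_def .
qed

subsection \<open>Picone's inequality\<close>

context periodic_solution
begin

lemma W1p: "W1p_deriv T p u (\<lambda>x. if x \<in> {0..T} then u' x else 0)"
proof (rule W1p_deriv_piecewise[OF p_gt_1 T_pos cont_u cont_u' refl])
  fix x assume "x \<in> {0<..<T} - {0, T}"
  then show "(u has_real_derivative (if x \<in> {0..T} then u' x else 0)) (at x)"
    using deriv_u_interior[of x] by auto
qed

text \<open>
  \<open>G = \<phi>\<^sub>p(u'/u)\<close> solves the Riccati equation \<open>G' = c - (p - 1) \<bar>u'/u\<bar>\<^sup>p\<close>; integrate \<open>(G \<bar>w\<bar>\<^sup>p)'\<close> over a period.
\<close>

lemma picone_has_integral:
  assumes pos: "\<And>x. x \<in> {0..T} \<Longrightarrow> u x > 0" and W: "W1p_periodic_deriv T p w v"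
  defines "\<theta> \<equiv> \<lambda>x. u' x * w x / u x"
  shows "((\<lambda>x. c x * \<bar>w x\<bar> powr p + (p * phi_p p (\<theta> x) * v x - (p - 1) * \<bar>\<theta> x\<bar> powr p))
    has_integral 0) {0..T}"
proof -
  define G where "G x = phi_p p (u' x) * u x powr (1 - p)" for x
  define g where "g x = c x - (p - 1) * (\<bar>u' x\<bar> powr p * u x powr (- p))" for x
  have u0: "u x \<noteq> 0" if "x \<in> {0..T}" for x using pos[OF that] by simp
  have G: "continuous_on {0..T} G" and g: "continuous_on {0..T} g"
    unfolding G_def g_def using p_gt_1 u0
    by (intro continuous_intros cont_u cont_u' cont_c; simp)+
  have DG: "(G has_real_derivative g x) (at x)" if x: "x \<in> {0<..<T}" for x
  proof -
    have ux: "u x > 0" using pos x by simp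
    have eq: "phi_p p (u x) * u x powr (1 - p) = 1"
      using ux by (simp add: phi_p_pos flip: powr_add)
    have "((\<lambda>y. u y powr (1 - p)) has_real_derivative (1 - p) * u x powr (1 - p - 1) * u' x) (at x)"
      by (rule DERIV_chain2[OF has_real_derivative_powr[OF ux] deriv_u_interior[OF x]])
    from DERIV_mult[OF deriv_flux[OF x] this]
    have "(G has_real_derivative c x * phi_p p (u x) * u x powr (1 - p) +
        (1 - p) * u x powr (1 - p - 1) * u' x * phi_p p (u' x)) (at x)"
      unfolding G_def .
    moreover have "c x * phi_p p (u x) * u x powr (1 - p) +
        (1 - p) * u x powr (1 - p - 1) * u' x * phi_p p (u' x) = g x"
      using eq by (simp add: g_def mult.assoc flip: phi_p_times_self) (simp add: algebra_simps)
    ultimately show ?thesis by simp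
  qed
  have W': "W1p_deriv T p w v" "w 0 = w T"
    using W by (auto simp: W1p_periodic_deriv_def)
  \<comment> \<open>Together with \<open>w 0 = w T\<close> this cancels the boundary terms.\<close>
  have "G 0 = G T" using periodic by (simp add: G_def)
  with W1p_weighted_powr_has_integral[OF p_gt_1 T_pos W'(1) G g DG] W'(2)
  have "((\<lambda>x. g x * \<bar>w x\<bar> powr p + G x * (p * phi_p p (w x)) * v x) has_integral 0) {0..T}"
    by simp
  then show ?thesis
  proof (rule has_integral_eq[rotated])
    fix x assume x: "x \<in> {0..T}"
    note ux = pos[OF x]
    have "phi_p p (\<theta> x) = phi_p p (u' x) * phi_p p (w x) * phi_p p (inverse (u x))"
      by (simp add: \<theta>_def divide_inverse phi_p_mult)
    also have "phi_p p (inverse (u x)) = u x powr (1 - p)"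
      using ux by (simp add: phi_p_pos powr_minus[symmetric] powr_powr inverse_powr)
    finally have 1: "phi_p p (\<theta> x) = G x * phi_p p (w x)"
      by (simp add: G_def)
    have 2: "\<bar>\<theta> x\<bar> powr p = \<bar>u' x\<bar> powr p * \<bar>w x\<bar> powr p * u x powr (- p)"
      using ux by (simp add: \<theta>_def abs_mult powr_mult powr_minus divide_inverse inverse_powr)
    show "g x * \<bar>w x\<bar> powr p + G x * (p * phi_p p (w x)) * v x =
      c x * \<bar>w x\<bar> powr p + (p * phi_p p (\<theta> x) * v x - (p - 1) * \<bar>\<theta> x\<bar> powr p)"
      unfolding 1 2 g_def by (simp add: algebra_simps)
  qed
qed

text \<open>The tangent inequality at \<open>\<theta>\<close>, applied to v pointwise, bounds the
  integrand from below by one whose integral is 0.\<close>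

lemma picone_energy_nonneg:
  assumes pos: "\<And>x. x \<in> {0..T} \<Longrightarrow> u x > 0" and W: "W1p_periodic_deriv T p w v"
  shows "0 \<le> integral {0..T} (\<lambda>x. \<bar>v x\<bar> powr p + c x * \<bar>w x\<bar> powr p)"
proof -
  have W': "W1p_deriv T p w v" using W by (simp add: W1p_periodic_deriv_def)
  then have w: "continuous_on {0..T} w" by (simp add: W1p_deriv_def)
  have int: "(\<lambda>x. \<bar>v x\<bar> powr p + c x * \<bar>w x\<bar> powr p) integrable_on {0..T}"
    using p_gt_1
    by (intro integrable_add set_lebesgue_integral_eq_integral(1)[OF W1p_abs_integrable(2)[OF p_gt_1 W']]
        integrable_continuous_real continuous_intros cont_c w) auto
  show ?thesis
  proof (rule has_integral_le[OF picone_has_integral[OF pos W] integrable_integral[OF int]])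
    fix x
    show "c x * \<bar>w x\<bar> powr p + (p * phi_p p (u' x * w x / u x) * v x
        - (p - 1) * \<bar>u' x * w x / u x\<bar> powr p) \<le> \<bar>v x\<bar> powr p + c x * \<bar>w x\<bar> powr p"
      using abs_powr_tangent[OF p_gt_1, of "u' x * w x / u x" "v x"] by linarith
  qed
qed

text \<open>For a solution w both the energy form and the Picone integral vanish. The defect
  \<open>D\<close> is continuous and nonnegative with integral 0, hence zero. Strict convexity gives
  w' = u' w / u, which says that w / u has derivative 0.\<close>

lemma pos_solution_unique:
  assumes pos: "\<And>x. x \<in> {0..T} \<Longrightarrow> u x > 0" and w: "periodic_solution T p c w w'"
  shows "\<exists>k. \<forall>x\<in>{0..T}. w x = k * u x"
proof -
  interpret w: periodic_solution T p c w w' by (rule w)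
  define \<theta> where "\<theta> x = u' x * w x / u x" for x
  define D where "D x = \<bar>w' x\<bar> powr p - (p * phi_p p (\<theta> x) * w' x - (p - 1) * \<bar>\<theta> x\<bar> powr p)" for x
  have u0: "u x \<noteq> 0" if "x \<in> {0..T}" for x using pos[OF that] by simp
  have D: "continuous_on {0..T} D"
  proof -
    have "continuous_on {0..T} \<theta>"
      unfolding \<theta>_def using u0 by (intro continuous_intros cont_u cont_u' w.cont_u) auto
    then show ?thesis
      unfolding D_def using p_gt_1 by (intro continuous_intros w.cont_u') auto
  qed
  have "((\<lambda>x. c x * \<bar>w x\<bar> powr p + (p * phi_p p (\<theta> x) * (if x \<in> {0..T} then w' x else 0)
      - (p - 1) * \<bar>\<theta> x\<bar> powr p)) has_integral 0) {0..T}"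
    unfolding \<theta>_def using w.W1p w.periodic
    by (intro picone_has_integral pos) (auto simp: W1p_periodic_deriv_def)
  moreover have "((\<lambda>x. \<bar>w' x\<bar> powr p + c x * \<bar>w x\<bar> powr p) has_integral 0) {0..T}"
    using w.energy_identity[of 0 T] w.periodic T_pos by simp
  ultimately have "((\<lambda>x. (\<bar>w' x\<bar> powr p + c x * \<bar>w x\<bar> powr p) - (c x * \<bar>w x\<bar> powr p +
      (p * phi_p p (\<theta> x) * (if x \<in> {0..T} then w' x else 0) - (p - 1) * \<bar>\<theta> x\<bar> powr p)))
      has_integral 0 - 0) {0..T}"
    by (rule has_integral_diff[rotated])
  then have "(D has_integral 0 - 0) {0..T}"
    by (rule has_integral_eq[rotated]) (simp add: D_def)
  then have "(D has_integral 0) (cbox 0 T)"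
    by simp
  moreover have nn: "0 \<le> D x" for x
    using abs_powr_tangent[OF p_gt_1, of "\<theta> x" "w' x"] by (simp add: D_def)
  ultimately have D0: "D x = 0" if "x \<in> {0..T}" for x
    using has_integral_0_cbox_imp_0[of 0 T D x] D T_pos that by auto
  have eq: "w' x = \<theta> x" if "x \<in> {0..T}" for x
    using D0[OF that] abs_powr_tangent_strict[OF p_gt_1, of "w' x" "\<theta> x"] by (auto simp: D_def)
  have "\<exists>k. \<forall>x\<in>{0..T}. w x / u x = k"
  proof (rule has_field_derivative_zero_constant)
    fix x assume x: "x \<in> {0..T}"
    show "((\<lambda>x. w x / u x) has_field_derivative 0) (at x within {0..T})"
      using DERIV_divide[OF w.deriv_u[OF x] deriv_u[OF x] u0[OF x]] eq[OF x] u0[OF x]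
      by (simp add: \<theta>_def)
  qed simp
  then show ?thesis using u0 by (force simp: field_simps)
qed

end

subsection \<open>Cut-off at a nodal interval\<close>

context periodic_solution
begin

text \<open>Take the last zero before z and the first one after it; they exist by compactness, and
  the intermediate value theorem excludes a sign change in between.\<close>

lemma pos_nodal_interval:
  assumes z: "0 \<le> z1" "z1 \<le> z" "z \<le> z2" "z2 \<le> T" and u: "u z1 = 0" "u z2 = 0" "u z > 0"
  obtains a b where "0 \<le> a" "a < b" "b \<le> T" "u a = 0" "u b = 0" "\<And>x. x \<in> {a<..<b} \<Longrightarrow> u x > 0"
proof -
  have cont: "continuous_on {x..y} u" if "0 \<le> x" "y \<le> T" for x y
    using that by (intro continuous_on_subset[OF cont_u]) auto
  have compact: "compact {x \<in> {s..t}. u x = 0}" if "0 \<le> s" "t \<le> T" for s t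
  proof -
    have "closed ({s..t} \<inter> u -` {0})"
      using that by (intro continuous_closed_preimage cont) auto
    moreover have "{x \<in> {s..t}. u x = 0} = {s..t} \<inter> u -` {0}" by auto
    ultimately show ?thesis
      using bounded_subset[OF bounded_closed_interval, of "{x \<in> {s..t}. u x = 0}" s t]
      by (auto simp: compact_eq_bounded_closed)
  qed
  obtain a where a: "a \<in> {z1..z}" "u a = 0" "\<And>x. x \<in> {z1..z} \<Longrightarrow> u x = 0 \<Longrightarrow> x \<le> a"
    using compact_attains_sup[OF compact[of z1 z]] z u by auto
  obtain b where b: "b \<in> {z..z2}" "u b = 0" "\<And>x. x \<in> {z..z2} \<Longrightarrow> u x = 0 \<Longrightarrow> b \<le> x"
    using compact_attains_inf[OF compact[of z z2]] z u by auto
  have nz: "a \<noteq> z" "b \<noteq> z" using a b u by auto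
  have pos: "u x > 0" if x: "x \<in> {a<..<b}" for x
  proof (rule ccontr)
    assume "\<not> u x > 0"
    then have ux: "u x \<le> 0" by simp
    show False
    proof (cases "x \<le> z")
      case True
      then obtain y where "x \<le> y" "y \<le> z" "u y = 0"
        using IVT'[of u x 0 z] ux u(3) cont[of x z] x a(1) z by auto
      with a(3)[of y] x a(1) show False by auto
    next
      case False
      then obtain y where "z \<le> y" "y \<le> x" "u y = 0"
        using IVT2'[of u x 0 z] ux u(3) cont[of z x] x b(1) z by auto
      with b(3)[of y] x b(1) show False by auto
    qed
  qed
  show thesis
    by (rule that[of a b]) (use a b z nz pos in auto)
qed

text \<open>
  Let \<open>w\<close> be \<open>u\<close> cut off outside a nodal interval \<open>[a,b]\<close>. The form \<open>J(w) = \<integral> \<bar>w'\<bar>\<^sup>p + c \<bar>w\<bar>\<^sup>p\<close> vanishes, and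
  adding a small constant \<open>t\<close> to \<open>w\<close> decreases it to first order, since
  \<open>\<integral> c \<phi>\<^sub>p(w) = \<phi>\<^sub>p(u'(b)) - \<phi>\<^sub>p(u'(a)) < 0\<close>.
\<close>

lemma pos_nodal_interval_energy_neg:
  assumes ab: "0 \<le> a" "a < b" "b \<le> T" "u a = 0" "u b = 0"
    and pos: "\<And>x. x \<in> {a<..<b} \<Longrightarrow> u x > 0"
  obtains w v where "W1p_periodic_deriv T p w v"
    "integral {0..T} (\<lambda>x. \<bar>v x\<bar> powr p + c x * \<bar>w x\<bar> powr p) < 0"
proof -
  define w where "w x = u (max a (min b x))" for x
  define v where "v x = (if x \<in> {a..b} then u' x else 0)" for x
  have sub: "{a..b} \<subseteq> {0..T}" using ab by auto
  have W: "W1p_periodic_deriv T p (\<lambda>x. w x + t) v" for t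
    unfolding W1p_periodic_deriv_def w_def v_def
  proof
    show "W1p_deriv T p (\<lambda>x. u (max a (min b x)) + t) (\<lambda>x. if x \<in> {a..b} then u' x else 0)"
      using ab by (intro W1p_deriv_clamp p_gt_1 T_pos continuous_on_subset[OF cont_u sub]
          continuous_on_subset[OF cont_u' sub] deriv_u_interior) auto
    show "u (max a (min b 0)) + t = u (max a (min b T)) + t"
      using ab by (simp add: max_def min_def)
  qed
  have w: "continuous_on {0..T} w"
    using W[of 0] by (simp add: W1p_periodic_deriv_def W1p_deriv_def)
  have w_in: "w x = u x" if "x \<in> {a..b}" for x
    using that by (cases "x = b") (simp_all add: w_def max_def min_def)
  have w_out: "w x = 0" if "x \<notin> {a..b}" for x
    using that ab by (auto simp: w_def max_def min_def)
  have w_nn: "w x \<ge> 0" for x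
    using pos[of x] ab w_in[of x] w_out[of x] by (cases "x \<in> {a..b}"; cases "x = a \<or> x = b") force+
  have extend: "((\<lambda>x. if x \<in> {a..b} then f x else 0) has_integral I) {0..T}"
    if "(f has_integral I) {a..b}" for f :: "real \<Rightarrow> real" and I
    using that sub by (subst has_integral_restrict) auto
  have J0: "((\<lambda>x. \<bar>v x\<bar> powr p + c x * \<bar>w x\<bar> powr p) has_integral 0) {0..T}"
    using energy_identity[of a b] ab
    by (intro has_integral_eq[OF _ extend]) (auto simp: w_in w_out v_def)
  define \<kappa> where "\<kappa> = phi_p p (u' a) - phi_p p (u' b)"
  have c\<phi>: "((\<lambda>x. c x * phi_p p (w x)) has_integral - \<kappa>) {0..T}"
    using flux_increment[of a b] ab
    by (intro has_integral_eq[OF _ extend]) (auto simp: w_in w_out \<kappa>_def)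
  have "u' a \<ge> 0" "u' b \<le> 0"
    using deriv_nonneg_left_endpoint[of a b] deriv_nonpos_right_endpoint[of a b] ab pos
    by (auto intro: less_imp_le)
  \<comment> \<open>A double zero at a would make u vanish at the midpoint. Hence
    \<open>u' b \<le> 0 < u' a\<close>, and the flux drops strictly.\<close>
  moreover have "u' a \<noteq> 0"
    using double_zero_trivial[of a "(a + b) / 2"] pos[of "(a + b) / 2"] ab by auto
  ultimately have \<kappa>: "\<kappa> > 0"
    using phi_p_strict_mono[OF p_gt_1, of "u' b" "u' a"] by (simp add: \<kappa>_def)
  obtain C where C: "\<And>x. x \<in> {0..T} \<Longrightarrow> \<bar>c x\<bar> \<le> C"
    using continuous_on_Icc_bound[OF cont_c] by blast
  have C0: "C \<ge> 0" using C[of 0] T_pos by force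
  obtain R where R: "\<And>x. x \<in> {0..T} \<Longrightarrow> \<bar>w x\<bar> \<le> R"
    using continuous_on_Icc_bound[OF w] by blast
  \<comment> \<open>With this choice the accumulated remainder C \<open>\<epsilon>\<close> T stays
    below the first-order gain \<open>\<kappa>\<close>; the summand 1 keeps the denominator positive
    when C = 0.\<close>
  define \<epsilon> where "\<epsilon> = \<kappa> / (2 * (C * T + 1))"
  have CT: "C * T + 1 > 0" using C0 T_pos by (simp add: add_nonneg_pos)
  have \<epsilon>: "\<epsilon> > 0" "C * \<epsilon> * T < \<kappa>"
  proof -
    show "\<epsilon> > 0" using \<kappa> CT by (simp add: \<epsilon>_def)
    have "2 * (C * T + 1) * \<epsilon> = \<kappa>" using CT by (simp add: \<epsilon>_def)
    moreover have "C * T * \<epsilon> \<ge> 0" using C0 T_pos \<open>\<epsilon> > 0\<close> by simp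
    ultimately show "C * \<epsilon> * T < \<kappa>" using \<open>\<epsilon> > 0\<close> by (simp add: algebra_simps)
  qed
  \<comment> \<open>Since t will be at most 1, this interval contains all values of w and of w +
    t.\<close>
  have "continuous_on {- (R + 1)..R + 1} (phi_p p)"
    using continuous_on_phi_p[OF p_gt_1 continuous_on_id] .
  then obtain d where d: "d > 0" "\<And>x y. x \<in> {- (R + 1)..R + 1} \<Longrightarrow> y \<in> {- (R + 1)..R + 1} \<Longrightarrow>
      \<bar>x - y\<bar> < d \<Longrightarrow> \<bar>phi_p p x - phi_p p y\<bar> < \<epsilon>"
    using continuous_on_Icc_uniform[OF _ \<epsilon>(1)] by blast
  define t where "t = min 1 (d / 2)"
  have t: "0 < t" "t \<le> 1" "t < d" using d(1) by (auto simp: t_def)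
  \<comment> \<open>As c may have either sign, the remainder \<open>r\<close> is bounded on both
    sides: below by the tangent at w, above by the tangent at w + t.\<close>
  have expand: "c x * \<bar>w x + t\<bar> powr p \<le>
      c x * \<bar>w x\<bar> powr p + (p * t * (c x * phi_p p (w x)) + p * t * (C * \<epsilon>))" if x: "x \<in> {0..T}" for x
  proof -
    define r where "r = \<bar>w x + t\<bar> powr p - \<bar>w x\<bar> powr p - p * t * phi_p p (w x)"
    have tangent: "\<bar>y\<bar> powr p + p * phi_p p y * (s - y) \<le> \<bar>s\<bar> powr p" for s y
      using abs_powr_tangent[OF p_gt_1, of y s]
      by (simp add: algebra_simps flip: phi_p_times_self[of p y])
    have "r \<ge> 0"
      using tangent[of "w x" "w x + t"] by (simp add: r_def algebra_simps)
    have "r \<le> p * t * (phi_p p (w x + t) - phi_p p (w x))"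
      using tangent[of "w x + t" "w x"] by (simp add: r_def algebra_simps)
    also have "\<dots> \<le> p * t * \<epsilon>"
    proof (intro mult_left_mono)
      have "\<bar>phi_p p (w x + t) - phi_p p (w x)\<bar> < \<epsilon>"
        by (rule d(2)) (use R[OF x] w_nn[of x] t in auto)
      then show "phi_p p (w x + t) - phi_p p (w x) \<le> \<epsilon>" by linarith
    qed (use t p_gt_1 in simp)
    finally have "\<bar>c x * r\<bar> \<le> C * (p * t * \<epsilon>)"
      unfolding abs_mult using C[OF x] C0 \<open>r \<ge> 0\<close> by (intro mult_mono) auto
    then have "c x * r \<le> C * (p * t * \<epsilon>)" by linarith
    then show ?thesis by (simp add: r_def algebra_simps)
  qed
  have vp: "(\<lambda>x. \<bar>v x\<bar> powr p) integrable_on {0..T}"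
    using W[of 0] unfolding W1p_periodic_deriv_def
    by (intro set_lebesgue_integral_eq_integral(1) W1p_abs_integrable(2)[OF p_gt_1]) (elim conjE)
  have "integral {0..T} (\<lambda>x. \<bar>v x\<bar> powr p + c x * \<bar>w x + t\<bar> powr p) \<le>
      0 + (p * t * (- \<kappa>) + p * t * (C * \<epsilon>) * T)"
  proof (rule has_integral_le)
    show "((\<lambda>x. \<bar>v x\<bar> powr p + c x * \<bar>w x + t\<bar> powr p) has_integral
        integral {0..T} (\<lambda>x. \<bar>v x\<bar> powr p + c x * \<bar>w x + t\<bar> powr p)) {0..T}"
      using p_gt_1
      by (intro integrable_integral integrable_add vp integrable_continuous_real
          continuous_intros cont_c w) auto
    have "((\<lambda>x. p * t * (C * \<epsilon>)) has_integral p * t * (C * \<epsilon>) * T) {0..T}"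
      using has_integral_const_real[of "p * t * (C * \<epsilon>)" 0 T] T_pos by (simp add: mult.commute)
    then show "((\<lambda>x. (\<bar>v x\<bar> powr p + c x * \<bar>w x\<bar> powr p) +
        (p * t * (c x * phi_p p (w x)) + p * t * (C * \<epsilon>))) has_integral
        0 + (p * t * (- \<kappa>) + p * t * (C * \<epsilon>) * T)) {0..T}"
      by (intro has_integral_add J0 has_integral_mult_right c\<phi>)
    show "\<bar>v x\<bar> powr p + c x * \<bar>w x + t\<bar> powr p \<le> (\<bar>v x\<bar> powr p + c x * \<bar>w x\<bar> powr p) +
        (p * t * (c x * phi_p p (w x)) + p * t * (C * \<epsilon>))" if "x \<in> {0..T}" for x
      using expand[OF that] by linarith
  qed
  also have "\<dots> = p * t * (C * \<epsilon> * T - \<kappa>)" by (simp add: algebra_simps)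
  also have "\<dots> < 0" using \<epsilon>(2) t(1) p_gt_1 by (intro mult_pos_neg) auto
  finally show thesis using that W by blast
qed

text \<open>To avoid a nodal interval that wraps around the period, use one of the sign opposite to
  the common end value \<open>u 0 = u T\<close>, or a negative one if that value is 0.\<close>

lemma changes_sign_energy_neg:
  assumes "changes_sign_on T u"
  obtains w v where "W1p_periodic_deriv T p w v"
    "integral {0..T} (\<lambda>x. \<bar>v x\<bar> powr p + c x * \<bar>w x\<bar> powr p) < 0"
proof -
  interpret neg: periodic_solution T p c "\<lambda>x. - u x" "\<lambda>x. - u' x" by (rule minus)
  have cont: "continuous_on {x..y} u" if "0 \<le> x" "y \<le> T" for x y
    using that by (intro continuous_on_subset[OF cont_u]) auto
  obtain x y where xy: "x \<in> {0..T}" "u x > 0" "y \<in> {0..T}" "u y < 0"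
    using assms by (auto simp: changes_sign_on_def)
  show thesis
  proof (cases "u 0 \<ge> 0")
    case True
    obtain z1 where z1: "0 \<le> z1" "z1 \<le> y" "u z1 = 0"
      using IVT2'[of u y 0 0] True xy cont[of 0 y] by auto
    obtain z2 where z2: "y \<le> z2" "z2 \<le> T" "u z2 = 0"
      using IVT'[of u y 0 T] True periodic xy cont[of y T] by auto
    obtain a b where "0 \<le> a" "a < b" "b \<le> T" "- u a = 0" "- u b = 0"
        "\<And>x. x \<in> {a<..<b} \<Longrightarrow> - u x > 0"
      using neg.pos_nodal_interval[of z1 y z2] z1 z2 xy by auto
    then show thesis using neg.pos_nodal_interval_energy_neg[of a b] that by blast
  next
    case False
    obtain z1 where z1: "0 \<le> z1" "z1 \<le> x" "u z1 = 0"
      using IVT'[of u 0 0 x] False xy cont[of 0 x] by auto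
    obtain z2 where z2: "x \<le> z2" "z2 \<le> T" "u z2 = 0"
      using IVT2'[of u T 0 x] False periodic xy cont[of x T] by auto
    obtain a b where "0 \<le> a" "a < b" "b \<le> T" "u a = 0" "u b = 0"
        "\<And>x. x \<in> {a<..<b} \<Longrightarrow> u x > 0"
      using pos_nodal_interval[of z1 x z2] z1 z2 xy by auto
    then show thesis using pos_nodal_interval_energy_neg[of a b] that by blast
  qed
qed

end

subsection \<open>The variational eigenvalue\<close>

text \<open>Only positivity of m somewhere is demanded, so that a sign-changing m and its negative
  both satisfy the assumptions.\<close>

locale indefinite_weight =
  fixes T p :: real and q m :: "real \<Rightarrow> real"
  assumes T_pos: "T > 0" and p_gt_1: "p > 1"
    and cont_q: "continuous_on {0..T} q" and q_nonneg: "x \<in> {0..T} \<Longrightarrow> q x \<ge> 0"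
    and q_nonzero: "\<exists>x\<in>{0..T}. q x \<noteq> 0"
    and cont_m: "continuous_on {0..T} m" and m_pos: "\<exists>x\<in>{0..T}. m x > 0"
begin

abbreviation mass :: "(real \<Rightarrow> real) \<Rightarrow> real" where
  "mass w \<equiv> integral {0..T} (\<lambda>x. m x * \<bar>w x\<bar> powr p)"

abbreviation lambda0 :: real where
  "lambda0 \<equiv> lambda0_plus T p q m"

lemma solution_E_iff:
  "solution_E T p q m lam u \<longleftrightarrow> (\<exists>u'. periodic_solution T p (\<lambda>x. q x - lam * m x) u u')"
  (is "_ \<longleftrightarrow> (\<exists>u'. ?P u')")
proof -
  have "(\<exists>w. (f has_real_derivative w) (at x) \<and> - w + q x * phi_p p s = lam * m x * phi_p p s) \<longleftrightarrow>
      (f has_real_derivative (q x - lam * m x) * phi_p p s) (at x)" for f x s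
  proof -
    have "- w + q x * phi_p p s = lam * m x * phi_p p s \<longleftrightarrow> w = (q x - lam * m x) * phi_p p s" for w
      by (auto simp: algebra_simps)
    then show ?thesis by simp
  qed
  moreover have "continuous_on {0..T} (\<lambda>x. q x - lam * m x)"
    by (intro continuous_intros cont_q cont_m)
  ultimately show ?thesis
    using T_pos p_gt_1 by (simp add: solution_E_def periodic_solution_def Ball_def conj_ac)
qed

lemma mass_integrable:
  "continuous_on {0..T} w \<Longrightarrow> (\<lambda>x. m x * \<bar>w x\<bar> powr p) integrable_on {0..T}"
  using p_gt_1 by (intro integrable_continuous_real continuous_intros cont_m) auto

lemma LINT_eq_mass:
  "continuous_on {0..T} w \<Longrightarrow> (LINT x:{0<..<T}|lebesgue. m x * \<bar>w x\<bar> powr p) = mass w"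
  using p_gt_1
  by (intro LINT_Ioo_eq_integral absolutely_integrable_continuous_real continuous_intros cont_m) auto

lemma energy_eq:
  assumes "W1p_deriv T p w v"
  shows "(\<lambda>x. \<bar>v x\<bar> powr p + q x * \<bar>w x\<bar> powr p) integrable_on {0..T}"
    "energy T p q w v = integral {0..T} (\<lambda>x. \<bar>v x\<bar> powr p + q x * \<bar>w x\<bar> powr p)"
proof -
  have "(\<lambda>x. \<bar>v x\<bar> powr p + q x * \<bar>w x\<bar> powr p) absolutely_integrable_on {0..T}"
    using assms p_gt_1
    by (intro set_integral_add W1p_abs_integrable(2) absolutely_integrable_continuous_real
        continuous_intros cont_q) (auto simp: W1p_deriv_def)
  then show "(\<lambda>x. \<bar>v x\<bar> powr p + q x * \<bar>w x\<bar> powr p) integrable_on {0..T}"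
    "energy T p q w v = integral {0..T} (\<lambda>x. \<bar>v x\<bar> powr p + q x * \<bar>w x\<bar> powr p)"
    unfolding energy_def by (auto intro: LINT_Ioo_eq_integral set_lebesgue_integral_eq_integral(1))
qed

lemma energy_nonneg: "W1p_deriv T p w v \<Longrightarrow> energy T p q w v \<ge> 0"
  unfolding energy_eq(2) using q_nonneg by (intro integral_nonneg energy_eq(1)) auto

lemma energy_minus_mass:
  assumes "W1p_deriv T p w v"
  shows "integral {0..T} (\<lambda>x. \<bar>v x\<bar> powr p + (q x - lam * m x) * \<bar>w x\<bar> powr p) =
    energy T p q w v - lam * mass w"
proof -
  have "continuous_on {0..T} w" using assms by (simp add: W1p_deriv_def)
  then have "integral {0..T} (\<lambda>x. (\<bar>v x\<bar> powr p + q x * \<bar>w x\<bar> powr p) - lam * (m x * \<bar>w x\<bar> powr p)) =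
      energy T p q w v - lam * mass w"
    unfolding energy_eq(2)[OF assms] integral_mult_right[symmetric]
    by (intro integral_diff energy_eq(1)[OF assms] integrable_on_mult_right mass_integrable)
  then show ?thesis by (simp add: algebra_simps)
qed

text \<open>Energy and mass are both homogeneous of degree p, so scaling by the mass to the power
  -1/p turns the constrained problem into one about the quotient.\<close>

lemma normalize:
  assumes W: "W1p_periodic_deriv T p w v" and M: "mass w > 0"
  obtains w1 v1 where "W1p_periodic_deriv T p w1 v1" "mass w1 = 1"
    "energy T p q w1 v1 = energy T p q w v / mass w"
proof -
  define k where "k = mass w powr (- 1 / p)"
  have k: "\<bar>k\<bar> powr p = inverse (mass w)"
  proof -
    have "\<bar>k\<bar> powr p = mass w powr (- 1)"
      using p_gt_1 by (simp add: k_def powr_powr)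
    then show ?thesis using M by (simp add: powr_minus)
  qed
  have W1: "W1p_deriv T p w v" "w 0 = w T" using W by (auto simp: W1p_periodic_deriv_def)
  note W2 = W1p_deriv_scale[OF W1(1), of k]
  show thesis
  proof (rule that)
    show "W1p_periodic_deriv T p (\<lambda>x. k * w x) (\<lambda>x. k * v x)"
      using W1 W2 by (simp add: W1p_periodic_deriv_def)
    have "mass (\<lambda>x. k * w x) = inverse (mass w) * mass w"
      unfolding integral_mult_right[symmetric] k[symmetric]
      by (simp add: abs_mult powr_mult mult.left_commute)
    then show "mass (\<lambda>x. k * w x) = 1" using M by simp
    have "energy T p q (\<lambda>x. k * w x) (\<lambda>x. k * v x) = inverse (mass w) * energy T p q w v"
      unfolding energy_eq(2)[OF W1(1)] energy_eq(2)[OF W2] integral_mult_right[symmetric] k[symmetric]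
      by (simp add: abs_mult powr_mult algebra_simps)
    then show "energy T p q (\<lambda>x. k * w x) (\<lambda>x. k * v x) = energy T p q w v / mass w"
      by (simp add: divide_inverse mult.commute)
  qed
qed

lemma lambda0_eq:
  "lambda0 = Inf {energy T p q u v | u v. W1p_periodic_deriv T p u v \<and> mass u = 1}"
proof -
  have "W1p_periodic_deriv T p u v \<and> (LINT x:{0<..<T}|lebesgue. m x * \<bar>u x\<bar> powr p) = 1 \<longleftrightarrow>
      W1p_periodic_deriv T p u v \<and> mass u = 1" for u v
    using LINT_eq_mass[of u] by (auto simp: W1p_periodic_deriv_def W1p_deriv_def)
  then show ?thesis unfolding lambda0_plus_def by simp
qed

text \<open>The constraint set must be nonempty for \<open>Inf\<close> to be meaningful. A parabolic
  bump over an interval on which m > 0 has positive mass.\<close>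

lemma positive_mass_exists: "\<exists>w v. W1p_periodic_deriv T p w v \<and> mass w > 0"
proof -
  obtain x0 where x0: "x0 \<in> {0..T}" "m x0 > 0" using m_pos by blast
  obtain d where d: "d > 0" "\<And>x. x \<in> {0..T} \<Longrightarrow> \<bar>x - x0\<bar> < d \<Longrightarrow> \<bar>m x - m x0\<bar> < m x0"
    using cont_m[unfolded continuous_on_iff, rule_format, OF x0] by (auto simp: dist_real_def)
  \<comment> \<open>Halving d keeps the closed interval inside the neighbourhood where m >
    0.\<close>
  define a b where "a = max 0 (x0 - d / 2)" and "b = min T (x0 + d / 2)"
  have ab: "0 \<le> a" "a < b" "b \<le> T" using x0 d(1) T_pos by (auto simp: a_def b_def)
  have m: "m x > 0" if "x \<in> {a..b}" for x
  proof -
    have "x \<in> {0..T}" "\<bar>x - x0\<bar> < d" using that d(1) x0 by (auto simp: a_def b_def)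
    from d(2)[OF this] show ?thesis by linarith
  qed
  define w where "w x = (max a (min b x) - a) * (b - max a (min b x))" for x
  define v where "v x = (if x \<in> {a..b} then a + b - 2 * x else 0)" for x
  have W: "W1p_deriv T p w v"
  proof -
    have "W1p_deriv T p (\<lambda>x. (max a (min b x) - a) * (b - max a (min b x)) + 0)
        (\<lambda>x. if x \<in> {a..b} then a + b - 2 * x else 0)"
    proof (rule W1p_deriv_clamp[OF p_gt_1 T_pos, where f = "\<lambda>x. (x - a) * (b - x)"])
      show "((\<lambda>x. (x - a) * (b - x)) has_real_derivative a + b - 2 * x) (at x)" for x
        by (auto intro!: derivative_eq_intros)
    qed (use ab in \<open>auto intro!: continuous_intros\<close>)
    then show ?thesis unfolding w_def[abs_def] v_def[abs_def] by simp
  qed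
  have per: "w 0 = w T" using ab by (simp add: w_def max_def min_def)
  define f where "f x = m x * \<bar>w x\<bar> powr p" for x
  have f: "continuous_on {0..T} f"
    unfolding f_def using W p_gt_1 by (intro continuous_intros cont_m) (auto simp: W1p_deriv_def)
  have nn: "f x \<ge> 0" if "x \<in> {0..T}" for x
  proof (cases "x \<in> {a..b}")
    case True
    then show ?thesis using m[OF True] by (simp add: f_def)
  next
    case False
    then have "w x = 0" using ab by (auto simp: w_def max_def min_def)
    then show ?thesis by (simp add: f_def)
  qed
  have mass_f: "mass w = integral {0..T} f" unfolding f_def ..
  have "mass w \<noteq> 0"
  proof
    assume "mass w = 0"
    then have "(f has_integral 0) {0..T}"
      using integrable_integral[OF integrable_continuous_real[OF f]] unfolding mass_f by simp
    then have "f ((a + b) / 2) = 0"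
      using has_integral_0_cbox_imp_0[of 0 T f "(a + b) / 2"] f nn T_pos ab by auto
    moreover have "w ((a + b) / 2) > 0"
    proof -
      have "max a (min b ((a + b) / 2)) = (a + b) / 2" using ab by auto
      then show ?thesis unfolding w_def using ab by (auto intro!: mult_pos_pos)
    qed
    ultimately show False using m[of "(a + b) / 2"] ab by (auto simp: f_def)
  qed
  moreover have "mass w \<ge> 0"
    unfolding mass_f by (rule integral_nonneg[OF integrable_continuous_real[OF f] nn])
  ultimately show ?thesis
    using W per by (intro exI[of _ w] exI[of _ v]) (simp add: W1p_periodic_deriv_def)
qed

lemma lambda0_greatest:
  assumes "\<And>w v. W1p_periodic_deriv T p w v \<Longrightarrow> mass w = 1 \<Longrightarrow> r \<le> energy T p q w v"
  shows "r \<le> lambda0"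
proof -
  obtain w0 v0 where "W1p_periodic_deriv T p w0 v0" "mass w0 > 0"
    using positive_mass_exists by blast
  then obtain w v where "W1p_periodic_deriv T p w v" "mass w = 1"
    by (rule normalize)
  then show ?thesis
    unfolding lambda0_eq by (intro cInf_greatest) (use assms in auto)
qed

lemma lambda0_nonneg: "lambda0 \<ge> 0"
  by (rule lambda0_greatest) (simp add: W1p_periodic_deriv_def energy_nonneg)

text \<open>Rescaling reduces positive mass to the definition. For nonpositive mass the left side is
  at most 0, because \<open>lambda0 \<ge> 0\<close>, while the energy is nonnegative.\<close>

lemma lambda0_mass_le_energy:
  assumes W: "W1p_periodic_deriv T p w v"
  shows "lambda0 * mass w \<le> energy T p q w v"
proof (cases "mass w > 0")
  case True
  obtain w1 v1 where w1: "W1p_periodic_deriv T p w1 v1" "mass w1 = 1"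
    "energy T p q w1 v1 = energy T p q w v / mass w"
    using normalize[OF W True] .
  have "lambda0 \<le> energy T p q w1 v1"
    unfolding lambda0_eq
  proof (rule cInf_lower)
    show "bdd_below {energy T p q u v | u v. W1p_periodic_deriv T p u v \<and> mass u = 1}"
      by (rule bdd_belowI[of _ 0]) (auto simp: W1p_periodic_deriv_def energy_nonneg)
  qed (use w1 in blast)
  with w1(3) True show ?thesis by (simp add: pos_le_divide_eq)
next
  case False
  then have "lambda0 * mass w \<le> 0"
    using lambda0_nonneg by (simp add: mult_nonneg_nonpos)
  also have "0 \<le> energy T p q w v"
    using W by (simp add: W1p_periodic_deriv_def energy_nonneg)
  finally show ?thesis .
qed

text \<open>Zero energy would give u' = 0 everywhere and u = 0 at a point where q is nonzero. That
  point is a double zero, so u would be trivial.\<close>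

lemma nontrivial_solution_W1p:
  assumes "periodic_solution T p (\<lambda>x. q x - lam * m x) u u'" and nt: "nontrivial_on T u"
  obtains v where "W1p_periodic_deriv T p u v" "energy T p q u v = lam * mass u" "energy T p q u v > 0"
proof -
  interpret periodic_solution T p "\<lambda>x. q x - lam * m x" u u' by (rule assms(1))
  define v where "v x = (if x \<in> {0..T} then u' x else 0)" for x
  have W: "W1p_deriv T p u v" using W1p by (simp add: v_def[abs_def])
  have "((\<lambda>x. \<bar>u' x\<bar> powr p + (q x - lam * m x) * \<bar>u x\<bar> powr p) has_integral 0) {0..T}"
    using energy_identity[of 0 T] T_pos periodic by simp
  then have "((\<lambda>x. \<bar>v x\<bar> powr p + (q x - lam * m x) * \<bar>u x\<bar> powr p) has_integral 0) {0..T}"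
    by (rule has_integral_eq[rotated]) (simp add: v_def)
  then have E: "energy T p q u v = lam * mass u"
    using energy_minus_mass[OF W, of lam] by (simp add: integral_unique)
  have "energy T p q u v \<noteq> 0"
  proof
    assume "energy T p q u v = 0"
    define f where "f x = \<bar>u' x\<bar> powr p + q x * \<bar>u x\<bar> powr p" for x
    have "((\<lambda>x. \<bar>v x\<bar> powr p + q x * \<bar>u x\<bar> powr p) has_integral 0) {0..T}"
      using integrable_integral[OF energy_eq(1)[OF W]] energy_eq(2)[OF W] \<open>energy T p q u v = 0\<close> by simp
    then have "(f has_integral 0) {0..T}"
      by (rule has_integral_eq[rotated]) (simp add: v_def f_def)
    moreover have "continuous_on {0..T} f"
      unfolding f_def using p_gt_1 by (intro continuous_intros cont_q cont_u cont_u') auto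
    moreover have "f x \<ge> 0" if "x \<in> {0..T}" for x
      using q_nonneg[OF that] by (simp add: f_def)
    ultimately have f0: "f x = 0" if "x \<in> {0..T}" for x
      using has_integral_0_cbox_imp_0[of 0 T f x] T_pos that by auto
    have f0': "u' x = 0 \<and> q x * \<bar>u x\<bar> powr p = 0" if "x \<in> {0..T}" for x
    proof -
      have "\<bar>u' x\<bar> powr p \<ge> 0" "q x * \<bar>u x\<bar> powr p \<ge> 0" using q_nonneg[OF that] by auto
      with f0[OF that] have "\<bar>u' x\<bar> powr p = 0" "q x * \<bar>u x\<bar> powr p = 0"
        unfolding f_def by linarith+
      then show ?thesis by simp
    qed
    obtain x where x: "x \<in> {0..T}" "q x \<noteq> 0" using q_nonzero by blast
    then have "u x = 0" using f0'[OF x(1)] by simp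
    then have "\<forall>y\<in>{0..T}. u y = 0"
      using double_zero_trivial[OF x(1)] f0'[OF x(1)] by blast
    with nt show False unfolding nontrivial_on_def by blast
  qed
  with energy_nonneg[OF W] have "energy T p q u v > 0" by linarith
  with W E periodic that show thesis by (simp add: W1p_periodic_deriv_def)
qed

section \<open>Eigenvalues and eigenfunctions compared with the variational value\<close>

lemma solution_eigenvalue_nonzero:
  assumes "periodic_solution T p (\<lambda>x. q x - lam * m x) u u'" "nontrivial_on T u"
  shows "lam \<noteq> 0"
  by (rule nontrivial_solution_W1p[OF assms]) auto

text \<open>Since the energy equals lam times the mass and is positive, the mass is positive too and
  can be cancelled in the variational inequality.\<close>

lemma positive_eigenvalue_ge_lambda0:
  assumes "periodic_solution T p (\<lambda>x. q x - lam * m x) u u'" "nontrivial_on T u" "lam > 0"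
  shows "lambda0 \<le> lam"
proof -
  obtain v where v: "W1p_periodic_deriv T p u v" "energy T p q u v = lam * mass u" "energy T p q u v > 0"
    using nontrivial_solution_W1p[OF assms(1,2)] .
  then have "mass u > 0" using assms(3) by (simp add: zero_less_mult_iff)
  with lambda0_mass_le_energy[OF v(1)] v(2) show ?thesis by simp
qed

lemma lambda0_solution_not_changes_sign:
  assumes "periodic_solution T p (\<lambda>x. q x - lambda0 * m x) u u'"
  shows "\<not> changes_sign_on T u"
proof
  interpret periodic_solution T p "\<lambda>x. q x - lambda0 * m x" u u' by (rule assms)
  assume "changes_sign_on T u"
  then obtain w v where "W1p_periodic_deriv T p w v"
    "integral {0..T} (\<lambda>x. \<bar>v x\<bar> powr p + (q x - lambda0 * m x) * \<bar>w x\<bar> powr p) < 0"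
    by (rule changes_sign_energy_neg)
  then show False
    using energy_minus_mass[of w v lambda0] lambda0_mass_le_energy[of w v]
    by (simp add: W1p_periodic_deriv_def)
qed

lemma positive_solution_eigenvalue_eq:
  assumes "periodic_solution T p (\<lambda>x. q x - lam * m x) u u'" and pos: "\<And>x. x \<in> {0..T} \<Longrightarrow> u x > 0"
    and lam: "lam > 0"
  shows "lam = lambda0"
proof (rule antisym)
  interpret periodic_solution T p "\<lambda>x. q x - lam * m x" u u' by (rule assms(1))
  show "lam \<le> lambda0"
  proof (rule lambda0_greatest)
    fix w v assume W: "W1p_periodic_deriv T p w v" and M: "mass w = 1"
    then have "W1p_deriv T p w v" by (simp add: W1p_periodic_deriv_def)
    with picone_energy_nonneg[OF pos W] have "0 \<le> energy T p q w v - lam * mass w"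
      by (simp only: energy_minus_mass)
    with M show "lam \<le> energy T p q w v" by simp
  qed
  have "nontrivial_on T u"
    using pos[of 0] T_pos unfolding nontrivial_on_def by force
  then show "lambda0 \<le> lam"
    using positive_eigenvalue_ge_lambda0[OF assms(1) _ lam] by blast
qed

lemma eigenfunction_lambda0_sign:
  assumes "eigenfunction_E T p q m lambda0 u"
  shows "(\<forall>x\<in>{0..T}. u x > 0) \<or> (\<forall>x\<in>{0..T}. u x < 0)"
proof -
  obtain u' where u': "periodic_solution T p (\<lambda>x. q x - lambda0 * m x) u u'"
    using assms by (auto simp: eigenfunction_E_def solution_E_iff)
  have "nontrivial_on T u" using assms by (simp add: eigenfunction_E_def)
  then show ?thesis
    by (rule periodic_solution.nontrivial_cases[OF u'])
       (use lambda0_solution_not_changes_sign[OF u'] in blast)+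
qed

lemma eigenfunction_lambda0_unique:
  assumes "eigenfunction_E T p q m lambda0 u" "eigenfunction_E T p q m lambda0 v"
  shows "\<exists>k. \<forall>x\<in>{0..T}. v x = k * u x"
proof -
  obtain u' v' where u': "periodic_solution T p (\<lambda>x. q x - lambda0 * m x) u u'"
    and v': "periodic_solution T p (\<lambda>x. q x - lambda0 * m x) v v'"
    using assms by (auto simp: eigenfunction_E_def solution_E_iff)
  from eigenfunction_lambda0_sign[OF assms(1)] show ?thesis
  proof
    assume "\<forall>x\<in>{0..T}. u x > 0"
    then show ?thesis using periodic_solution.pos_solution_unique[OF u' _ v'] by blast
  next
    assume "\<forall>x\<in>{0..T}. u x < 0"
    then obtain k where "\<forall>x\<in>{0..T}. v x = k * - u x"
      using periodic_solution.pos_solution_unique[OF periodic_solution.minus[OF u'] _ v'] by force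
    then show ?thesis by (intro exI[of _ "- k"]) simp
  qed
qed

lemma eigenfunction_changes_sign:
  assumes "eigenfunction_E T p q m lam u" "lam > 0" "lam \<noteq> lambda0"
  shows "changes_sign_on T u"
proof -
  obtain u' where u': "periodic_solution T p (\<lambda>x. q x - lam * m x) u u'"
    using assms by (auto simp: eigenfunction_E_def solution_E_iff)
  have "nontrivial_on T u" using assms by (simp add: eigenfunction_E_def)
  then show ?thesis
  proof (rule periodic_solution.nontrivial_cases[OF u'])
    assume "\<And>x. x \<in> {0..T} \<Longrightarrow> u x > 0"
    then show ?thesis using positive_solution_eigenvalue_eq[OF u' _ assms(2)] assms(3) by blast
  next
    assume "\<And>x. x \<in> {0..T} \<Longrightarrow> u x < 0"
    then show ?thesis
      using positive_solution_eigenvalue_eq[OF periodic_solution.minus[OF u'] _ assms(2)] assms(3)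
      by (metis neg_0_less_iff_less)
  qed
qed

end

section \<open>Reflection of the weight and conclusion\<close>

lemma solution_E_minus: "solution_E T p q (\<lambda>x. - m x) (- lam) u \<longleftrightarrow> solution_E T p q m lam u"
  by (simp add: solution_E_def)

lemma eigenfunction_E_minus:
  "eigenfunction_E T p q (\<lambda>x. - m x) (- lam) u \<longleftrightarrow> eigenfunction_E T p q m lam u"
  by (simp add: eigenfunction_E_def solution_E_minus)

text \<open>On the reals \<open>Inf\<close> is defined as the negated \<open>Sup\<close> of the
  negated set, so the identity holds without any boundedness condition.\<close>

lemma lambda0_minus_eq: "lambda0_minus T p q m = - lambda0_plus T p q (\<lambda>x. - m x)"
proof -
  have "{- energy T p q u v | u v. P u v} = uminus ` {energy T p q u v | u v. P u v}" for P
    by auto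
  then show ?thesis
    unfolding lambda0_minus_def lambda0_plus_def Inf_real_def by simp
qed

theorem theorem3p1:
  fixes T p :: real and q m :: "real \<Rightarrow> real"
  assumes "T > 0" and "p > 1"
    and "continuous_on {0..T} q" and "\<forall>x\<in>{0..T}. q x \<ge> 0" and "\<exists>x\<in>{0..T}. q x \<noteq> 0"
    and "continuous_on {0..T} m" and "changes_sign_on T m"
  shows "(\<forall>lam. lambda0_minus T p q m < lam \<and> lam < lambda0_plus T p q m \<longrightarrow>
            \<not> (\<exists>u. solution_E T p q m lam u \<and> nontrivial_on T u)) \<and>
         (\<forall>lam\<in>{lambda0_plus T p q m, lambda0_minus T p q m}.
            \<forall>u. eigenfunction_E T p q m lam u \<longrightarrow>
              (\<forall>x\<in>{0..T}. u x > 0) \<or> (\<forall>x\<in>{0..T}. u x < 0)) \<and>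
         (\<forall>lam\<in>{lambda0_plus T p q m, lambda0_minus T p q m}.
            \<forall>u v. eigenfunction_E T p q m lam u \<and> eigenfunction_E T p q m lam v \<longrightarrow>
              (\<exists>c. \<forall>x\<in>{0..T}. v x = c * u x)) \<and>
         (\<forall>lam u. eigenvalue_E T p q m lam \<and> eigenfunction_E T p q m lam u \<and>
            lam \<noteq> lambda0_plus T p q m \<and> lam \<noteq> lambda0_minus T p q m \<longrightarrow>
              changes_sign_on T u)"
proof -
  interpret plus: indefinite_weight T p q m
    using assms unfolding indefinite_weight_def changes_sign_on_def by blast
  interpret minus: indefinite_weight T p q "\<lambda>x. - m x"
    using assms by unfold_locales (auto simp: changes_sign_on_def intro!: continuous_intros)
  let ?mu = "lambda0_plus T p q (\<lambda>x. - m x)"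
  have nonzero: "lam \<noteq> 0" if "solution_E T p q m lam u" "nontrivial_on T u" for lam u
    using that plus.solution_eigenvalue_nonzero unfolding plus.solution_E_iff by blast
  have ge_plus: "lambda0_plus T p q m \<le> lam"
    if "solution_E T p q m lam u" "nontrivial_on T u" "lam > 0" for lam u
    using that plus.positive_eigenvalue_ge_lambda0 unfolding plus.solution_E_iff by blast
  have ge_minus: "?mu \<le> - lam"
    if "solution_E T p q m lam u" "nontrivial_on T u" "lam < 0" for lam u
    using that minus.positive_eigenvalue_ge_lambda0[of "- lam" u]
    unfolding solution_E_minus[of T p q m, symmetric] minus.solution_E_iff by auto
  have minus_iff: "eigenfunction_E T p q m (- ?mu) u \<longleftrightarrow> eigenfunction_E T p q (\<lambda>x. - m x) ?mu u" for u
    using eigenfunction_E_minus[of T p q m "- ?mu" u] by simp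
  have no_solution: "\<not> (\<exists>u. solution_E T p q m lam u \<and> nontrivial_on T u)"
    if "- ?mu < lam" "lam < lambda0_plus T p q m" for lam
  proof
    assume "\<exists>u. solution_E T p q m lam u \<and> nontrivial_on T u"
    then obtain u where u: "solution_E T p q m lam u" "nontrivial_on T u" by blast
    with nonzero[OF u] ge_plus[OF u] ge_minus[OF u] that show False by linarith
  qed
  have sign: "(\<forall>x\<in>{0..T}. u x > 0) \<or> (\<forall>x\<in>{0..T}. u x < 0)"
    if "lam \<in> {lambda0_plus T p q m, - ?mu}" "eigenfunction_E T p q m lam u" for lam u
    using that plus.eigenfunction_lambda0_sign[of u] minus.eigenfunction_lambda0_sign[of u]
      minus_iff[of u] by (elim insertE emptyE) simp_all
  have simple: "\<exists>c. \<forall>x\<in>{0..T}. v x = c * u x"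
    if "lam \<in> {lambda0_plus T p q m, - ?mu}" "eigenfunction_E T p q m lam u"
      "eigenfunction_E T p q m lam v" for lam u v
    using that plus.eigenfunction_lambda0_unique[of u v] minus.eigenfunction_lambda0_unique[of u v]
      minus_iff[of u] minus_iff[of v] by (elim insertE emptyE) simp_all
  have changes: "changes_sign_on T u"
    if u: "eigenfunction_E T p q m lam u" and "lam \<noteq> lambda0_plus T p q m" "lam \<noteq> - ?mu" for lam u
  proof -
    \<comment> \<open>The value 0 is excluded by positivity of the energy. Negative eigenvalues for
      m are positive ones for \<open>- m\<close>.\<close>
    consider "lam > 0" | "- lam > 0"
      using nonzero[of lam u] u by (fastforce simp: eigenfunction_E_def)
    then show ?thesis
    proof cases
      case 1
      then show ?thesis using plus.eigenfunction_changes_sign[OF u] that by blast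
    next
      case 2
      then show ?thesis
        using minus.eigenfunction_changes_sign[of "- lam" u] eigenfunction_E_minus[of T p q m lam u] that
        by auto
    qed
  qed
  show ?thesis
    unfolding lambda0_minus_eq
    by (intro conjI allI impI ballI; (elim conjE)?)
      (rule no_solution sign simple changes; assumption)+
qed

end
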